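(* Let $\mathcal{M}=(S,A,P,s_0)$ be a Markov decision process, let $R^{\mathcal{A}}\subseteq S$ be a set of absorbing states, let $\nu^{\mathcal{A}}\in[0,1]$, and let $\pi^{\mathcal{S}}$ be a stationary (reference) policy on $\mathcal{M}$. For any policy $\pi^{\mathcal{A}}\in\Pi(\mathcal{M})$ that satisfies ${\Pr}^{\pi^{\mathcal{A}}}_{\mathcal{M}}(s_0\models\lozenge R^{\mathcal{A}})\ge\nu^{\mathcal{A}}$, there exists a stationary policy $\pi^{\mathcal{A},St}\in\Pi(\mathcal{M})$ that satisfies ${\Pr}^{\pi^{\mathcal{A},St}}_{\mathcal{M}}(s_0\models\lozenge R^{\mathcal{A}})\ge\nu^{\mathcal{A}}$ and $$KL\left(\Gamma^{\pi^{\mathcal{A},St}}_{\mathcal{M}}\,\|\,\Gamma^{\pi^{\mathcal{S}}}_{\mathcal{M}}\right)\le KL\left(\Gamma^{\pi^{\mathcal{A}}}_{\mathcal{M}}\,\|\,\Gamma^{\pi^{\mathcal{S}}}_{\mathcal{M}}\right).$$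
   Context: A Markov decision process (MDP) is a tuple $\mathcal{M}=(S,A,P,s_0)$ with finite state set $S$, finite action set $A$, transition function $P:S\times A\times S\to[0,1]$ and initial state $s_0$; $A(s)$ is the set of actions available at $s$, and $\sum_{q\in S}P(s,a,q)=1$ for $a\in A(s)$. A state $s$ is absorbing if $P(s,a,s)=1$ for all $a\in A(s)$. A history at time $t$ is $h_t=s_0a_0s_1\ldots s_{t-1}a_{t-1}s_t$. A policy is a sequence $\pi=\mu_0\mu_1\ldots$ where $\mu_t$ assigns to each history $h_t$ a probability distribution $\mu_t(h_t,\cdot)$ on $A(s_t)$; $\Pi(\mathcal{M})$ is the set of all policies. A stationary policy is $\pi=\mu\mu\ldots$ with $\mu(s,\cdot)$ a (possibly randomized) probability distribution on $A(s)$ depending only on the current state. A path is an infinite sequence of states $s_0s_1s_2\ldots$ (actions are not recorded); $\Gamma^{\pi}_{\mathcal{M}}$ is the distribution of paths under $\pi$. $KL(Q_1\|Q_2)\in[0,\infty]$ is the Kullback--Leibler divergence with natural logarithm, for discrete distributions $\sum_x Q_1(x)\log(Q_1(x)/Q_2(x))$, where a term is $0$ if $Q_1(x)=0$ and $\infty$ if $Q_1(x)>0=Q_2(x)$; for path distributions it is the relative entropy of the measures on infinite state sequences, equivalently the limit as $k\to\infty$ of the KL divergences between the distributions of the first $k+1$ states. $\Pr^{\pi}_{\mathcal{M}}(s_0\models\lozenge R)$ is the probability under $\pi$ that the path visits some state of $R$. *)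

theory Defs
  imports "HOL-Probability.Probability"
begin

text \<open>
  The finite sets of states and actions are the types \<open>'s\<close> and \<open>'a\<close>. The transition law of
  an action that is not available in a state is never used.
\<close>

record ('s, 'a) mdp =
  avail :: "'s \<Rightarrow> 'a set"
  trans :: "'s \<Rightarrow> 'a \<Rightarrow> 's pmf"
  init  :: 's

definition absorbing :: "('s, 'a) mdp \<Rightarrow> 's \<Rightarrow> bool" where
  "absorbing M s \<longleftrightarrow> (\<forall>a\<in>avail M s. pmf (trans M s a) s = 1)"

text \<open>The history $s_0 a_0 s_1 \ldots a_{t-1} s_t$ is \<open>(s\<^sub>0, [(a\<^sub>0, s\<^sub>1), \<dots>, (a\<^sub>t\<^sub>-\<^sub>1, s\<^sub>t)])\<close>.\<close>

type_synonym ('s, 'a) history = "'s \<times> ('a \<times> 's) list"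

fun last_state :: "('s, 'a) history \<Rightarrow> 's" where
  "last_state (s, []) = s"
| "last_state (s, x # xs) = snd (last (x # xs))"

text \<open>
  The length of a history determines its time, so a sequence of decision rules, the \<open>t\<close>-th of
  which acts on the histories at time \<open>t\<close>, is a single function on histories of any length.
\<close>

type_synonym ('s, 'a) policy = "('s, 'a) history \<Rightarrow> 'a pmf"

definition policies :: "('s, 'a) mdp \<Rightarrow> ('s, 'a) policy set" where
  "policies M = {\<pi>. \<forall>h. set_pmf (\<pi> h) \<subseteq> avail M (last_state h)}"

definition stationary :: "('s, 'a) policy \<Rightarrow> bool" where
  "stationary \<pi> \<longleftrightarrow> (\<exists>\<mu>. \<forall>h. \<pi> h = \<mu> (last_state h))"

definition step :: "('s, 'a) mdp \<Rightarrow> ('s, 'a) policy \<Rightarrow> ('s, 'a) history \<Rightarrow> ('a \<times> 's) pmf" where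
  "step M \<pi> h = do {a \<leftarrow> \<pi> h; s \<leftarrow> trans M (last_state h) a; return_pmf (a, s)}"

text \<open>The \<open>t\<close>-th coordinate of a run is the pair $(a_t, s_{t+1})$.\<close>

definition run_kernel ::
  "('s, 'a) mdp \<Rightarrow> ('s, 'a) policy \<Rightarrow> nat \<Rightarrow> (nat \<Rightarrow> 'a \<times> 's) \<Rightarrow> ('a \<times> 's) measure" where
  "run_kernel M \<pi> t \<omega> = measure_pmf (step M \<pi> (init M, map \<omega> [0..<t]))"

global_interpretation run: Ionescu_Tulcea "run_kernel M \<pi>" "\<lambda>_. count_space UNIV"
  for M :: "('s::finite, 'a::finite) mdp" and \<pi> :: "('s, 'a) policy"
  defines run_measure = run.PF.lim
proof (rule Ionescu_Tulcea.intro)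
  show "run_kernel M \<pi> t \<in>
      measurable (PiM {0..<t} (\<lambda>_. count_space UNIV)) (subprob_algebra (count_space UNIV))" for t
  proof -
    have "PiM {0..<t} (\<lambda>_. count_space UNIV) =
        count_space (PiE {0..<t} (\<lambda>_. UNIV :: ('a \<times> 's) set))"
      by (intro count_space_PiM_finite) auto
    then show ?thesis
      by (auto simp: run_kernel_def space_subprob_algebra
          intro!: prob_space_imp_subprob_space measure_pmf.prob_space_axioms)
  qed
  show "prob_space (run_kernel M \<pi> t \<omega>)" for t and \<omega> :: "nat \<Rightarrow> 'a \<times> 's"
    by (simp add: run_kernel_def measure_pmf.prob_space_axioms)
qed

definition path_space :: "(nat \<Rightarrow> 's) measure" where
  "path_space = PiM UNIV (\<lambda>_. count_space UNIV)"

definition path_measure ::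
  "('s::finite, 'a::finite) mdp \<Rightarrow> ('s, 'a) policy \<Rightarrow> (nat \<Rightarrow> 's) measure" where
  "path_measure M \<pi> =
    distr (run_measure M \<pi>) path_space (\<lambda>\<omega>. case_nat (init M) (\<lambda>t. snd (\<omega> t)))"

definition reach_prob ::
  "('s::finite, 'a::finite) mdp \<Rightarrow> ('s, 'a) policy \<Rightarrow> 's set \<Rightarrow> real" where
  "reach_prob M \<pi> R = measure (path_measure M \<pi>) {p. \<exists>t. p t \<in> R}"

text \<open>
  The library's \<open>KL_divergence b N M\<close> is the divergence of \<open>M\<close> from \<open>N\<close> with logarithm to
  base \<open>b\<close>. It is real-valued, hence meaningful only if \<open>M\<close> is absolutely continuous with
  respect to \<open>N\<close> and the logarithm of the density is \<open>M\<close>-integrable. For probability measures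
  the negative part of that logarithm is always \<open>M\<close>-integrable, so the divergence is infinite
  in all remaining cases.
\<close>

definition KL :: "'x measure \<Rightarrow> 'x measure \<Rightarrow> ereal" where
  "KL Q\<^sub>1 Q\<^sub>2 =
    (if absolutely_continuous Q\<^sub>2 Q\<^sub>1 \<and> integrable Q\<^sub>1 (entropy_density (exp 1) Q\<^sub>2 Q\<^sub>1)
     then ereal (KL_divergence (exp 1) Q\<^sub>2 Q\<^sub>1) else \<infinity>)"

end

(* The divergence of path laws sees only transitions, so let P be the transition kernel of the
   reference policy and T the set of states outside R from which R is P-reachable. The complement
   of T is closed under P, and P leaves T exponentially fast, which gives a Lyapunov function.

   If the divergence of the given policy A is infinite, it suffices to maximise the probability of
   reaching R among stationary policies; discounting with a factor tending to 1 shows that one of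
   the finitely many deterministic ones is optimal.

   If it is finite, the Donsker-Varadhan inequality applied to the Lyapunov function bounds the
   expected number x(s) of visits of A to each s in T. Let the new policy use the action
   frequencies of A at the states of T with x(s) > 0 and the reference policy elsewhere, and let Q
   be its kernel. Then x is a solution of the balance equations of Q on T; testing it against
   functions shows that Q reaches R with the same probability as A and visits no state of T more
   often than A in expectation. The likelihood ratio L_n of Q against P up to time n is a product
   of one-step ratios that are 1 off T, and Q leaves T, so L_n is eventually constant and its limit
   is the density of the path laws. Hence the divergence of Q is at most the sum over T of
   x(s) KL(Q_s || P_s). By the definition of Q this sum is the limit of the expectation of log L_n
   under A, which the Donsker-Varadhan inequality bounds by the divergence of A; no convexity
   argument is needed. *)

theory Submission
  imports Defs
begin

subsection \<open>Finite-dimensional distributions of runs and paths\<close>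

lemma last_state_snoc [simp]: "last_state (s, l @ [x]) = snd x"
  by (cases l) auto

text \<open>The law of the first \<open>n\<close> coordinates of a run as a discrete distribution,
  so that finite-horizon computations stay within \<open>pmf\<close>.\<close>

primrec hist :: "('s, 'a) mdp \<Rightarrow> ('s, 'a) policy \<Rightarrow> nat \<Rightarrow> ('a \<times> 's) list pmf" where
  "hist M \<pi> 0 = return_pmf []"
| "hist M \<pi> (Suc n) =
    bind_pmf (hist M \<pi> n) (\<lambda>l. map_pmf (\<lambda>x. l @ [x]) (step M \<pi> (init M, l)))"

lemma measurable_fin_PiM:
  fixes f :: "(nat \<Rightarrow> 'b::finite) \<Rightarrow> 'c"
  shows "(\<lambda>\<omega>. f \<omega>) \<in> measurable (PiM {0..<n::nat} (\<lambda>_. count_space UNIV)) (count_space UNIV)"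
    and "f' \<in> borel_measurable (PiM {0..<n::nat} (\<lambda>_. count_space (UNIV :: 'b set)))"
proof -
  have "PiM {0..<n} (\<lambda>_. count_space UNIV) = count_space (PiE {0..<n} (\<lambda>_. UNIV :: 'b set))"
    by (intro count_space_PiM_finite) auto
  then show "(\<lambda>\<omega>. f \<omega>) \<in> measurable (PiM {0..<n} (\<lambda>_. count_space UNIV)) (count_space UNIV)"
    and "f' \<in> borel_measurable (PiM {0..<n} (\<lambda>_. count_space (UNIV :: 'b set)))"
    by auto
qed

text \<open>Stated for all nonnegative \<open>f\<close> rather than for events, because the
  induction applies the hypothesis to the function obtained by integrating out the last
  coordinate.\<close>

lemma nn_integral_C_hist:
  fixes M :: "('s::finite, 'a::finite) mdp" and f :: "('a \<times> 's) list \<Rightarrow> ennreal"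
  shows "(\<integral>\<^sup>+\<omega>. f (map \<omega> [0..<n]) \<partial>run.C M \<pi> 0 n (\<lambda>_. undefined)) = (\<integral>\<^sup>+l. f l \<partial>hist M \<pi> n)"
proof (induction n arbitrary: f)
  case 0
  show ?case
    by (simp only: run.C.simps, subst nn_integral_return)
      (auto simp: space_PiM)
next
  case (Suc n)
  let ?u = "\<lambda>_::nat. undefined :: 'a \<times> 's"
  let ?P = "\<lambda>n. PiM {0..<n} (\<lambda>_. count_space UNIV) :: (nat \<Rightarrow> 'a \<times> 's) measure"
  have u: "?u \<in> space (?P 0)" by (simp add: space_PiM)
  have "(\<integral>\<^sup>+\<omega>. f (map \<omega> [0..<Suc n]) \<partial>run.C M \<pi> 0 (Suc n) ?u)
      = (\<integral>\<^sup>+\<omega>. \<integral>\<^sup>+\<omega>'. f (map \<omega>' [0..<Suc n]) \<partial>run.eP M \<pi> n \<omega> \<partial>run.C M \<pi> 0 n ?u)"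
  proof (unfold run.C.simps add_0, rule nn_integral_bind)
    show "run.eP M \<pi> n \<in> measurable (run.C M \<pi> 0 n ?u) (subprob_algebra (?P (Suc n)))"
      using run.measurable_eP[of M \<pi> n] run.sets_C[OF u, of M \<pi> n]
      unfolding add_0 by (subst measurable_cong_sets) auto
  qed (rule measurable_fin_PiM)
  also have "\<dots> = (\<integral>\<^sup>+\<omega>. \<integral>\<^sup>+x. f (map \<omega> [0..<n] @ [x]) \<partial>step M \<pi> (init M, map \<omega> [0..<n])
      \<partial>run.C M \<pi> 0 n ?u)"
  proof (rule nn_integral_cong)
    fix \<omega> assume "\<omega> \<in> space (run.C M \<pi> 0 n ?u)"
    then have \<omega>: "\<omega> \<in> space (?P n)" by (simp add: run.space_C[OF u])
    have eq: "map (fun_upd \<omega> n x) [0..<Suc n] = map \<omega> [0..<n] @ [x]" for x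
      by (auto intro!: map_cong)
    show "(\<integral>\<^sup>+\<omega>'. f (map \<omega>' [0..<Suc n]) \<partial>run.eP M \<pi> n \<omega>)
        = (\<integral>\<^sup>+x. f (map \<omega> [0..<n] @ [x]) \<partial>step M \<pi> (init M, map \<omega> [0..<n]))"
      by (subst run.nn_integral_eP[OF \<omega>]) (simp_all only: measurable_fin_PiM eq run_kernel_def)
  qed
  also have "\<dots> = (\<integral>\<^sup>+l. \<integral>\<^sup>+x. f (l @ [x]) \<partial>step M \<pi> (init M, l) \<partial>hist M \<pi> n)"
    by (rule Suc.IH)
  also have "\<dots> = (\<integral>\<^sup>+l. f l \<partial>hist M \<pi> (Suc n))"
    by (simp add: nn_integral_bind_pmf)
  finally show ?case .
qed

lemma measurable_map_upt:
  "(\<lambda>\<omega>. map \<omega> [0..<n]) \<in>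
    measurable (PiM UNIV (\<lambda>_. count_space UNIV)) (count_space (UNIV :: 'b::finite list set))"
proof -
  let ?P = "PiM UNIV (\<lambda>_. count_space UNIV) :: (nat \<Rightarrow> 'b) measure"
  have "(\<lambda>\<omega>. map \<omega> [0..<n]) -` {xs} \<inter> space ?P \<in> sets ?P" for xs
  proof -
    have eq: "map \<omega> [0..<n] = xs \<longleftrightarrow> length xs = n \<and> (\<forall>i\<in>{..<n}. \<omega> i = xs ! i)"
      for \<omega> :: "nat \<Rightarrow> 'b"
      by (simp only: list_eq_iff_nth_eq) auto
    have "{\<omega> \<in> space ?P. \<omega> i = xs ! i} \<in> sets ?P" for i
      using measurable_sets[OF measurable_component_singleton[of i UNIV "\<lambda>_. count_space UNIV"],
          of "{xs ! i}"]
      by (simp add: vimage_def space_PiM)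
    then have "{\<omega> \<in> space ?P. \<forall>i\<in>{..<n}. \<omega> i = xs ! i} \<in> sets ?P"
      by (intro sets.sets_Collect_finite_All) auto
    moreover have "(\<lambda>\<omega>. map \<omega> [0..<n]) -` {xs} \<inter> space ?P =
        (if length xs = n then {\<omega> \<in> space ?P. \<forall>i\<in>{..<n}. \<omega> i = xs ! i} else {})"
      using eq by auto
    ultimately show ?thesis by simp
  qed
  then show ?thesis
    by (subst measurable_count_space_eq2_countable) auto
qed

lemma distr_run_measure:
  fixes M :: "('s::finite, 'a::finite) mdp"
  shows "distr (run_measure M \<pi>) (count_space UNIV) (\<lambda>\<omega>. map \<omega> [0..<n]) = measure_pmf (hist M \<pi> n)"
proof (rule measure_eqI)
  let ?u = "\<lambda>_::nat. undefined :: 'a \<times> 's"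
  let ?P = "\<lambda>J. PiM J (\<lambda>_. count_space UNIV) :: (nat \<Rightarrow> 'a \<times> 's) measure"
  fix X assume "X \<in> sets (distr (run_measure M \<pi>) (count_space UNIV) (\<lambda>\<omega>. map \<omega> [0..<n]))"
  have u: "?u \<in> space (?P {0..<0})" by (simp add: space_PiM)
  have S: "sets (run_measure M \<pi>) = sets (?P UNIV)"
    by (rule run.PF.sets_lim)
  \<comment> \<open>The marginal \<open>run.CI\<close> on an index set is cut out of
    \<open>run.C\<close> with horizon \<open>run.up_to\<close>, the least bound of that set; for
    \<open>{0..<n}\<close> this is \<open>n\<close>.\<close>
  have up: "run.up_to {0..<n} = n"
  proof (rule antisym)
    show "n \<le> run.up_to {0..<n}"
      using run.up_to[of "{0..<n}"] by (cases "n = 0") auto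
  qed (simp add: run.up_to_iff)
  have m: "(\<lambda>\<omega>. restrict \<omega> {0..<n}) \<in> measurable (?P UNIV) (?P {0..<n})"
    by (intro measurable_restrict_subset) auto
  have mC: "measurable (run.C M \<pi> 0 n ?u) N = measurable (?P {0..<n}) N" for N :: "'x measure"
    using run.sets_C[OF u, of M \<pi> n] by (intro measurable_cong_sets) auto
  have r: "map (restrict \<omega> {0..<n}) [0..<n] = map \<omega> [0..<n]" for \<omega> :: "nat \<Rightarrow> 'a \<times> 's"
    by (auto intro!: map_cong)
  have "emeasure (distr (run_measure M \<pi>) (count_space UNIV) (\<lambda>\<omega>. map \<omega> [0..<n])) X
      = (\<integral>\<^sup>+\<omega>. indicator X (map \<omega> [0..<n]) \<partial>run_measure M \<pi>)"
    using measurable_map_upt[of n, where 'b="'a \<times> 's"]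
    by (subst nn_integral_indicator[symmetric], simp, subst nn_integral_distr)
       (auto simp: measurable_cong_sets[OF S refl])
  also have "\<dots> = (\<integral>\<^sup>+\<omega>. indicator X (map \<omega> [0..<n])
      \<partial>distr (run_measure M \<pi>) (?P {0..<n}) (\<lambda>\<omega>. restrict \<omega> {0..<n}))"
    using m by (subst nn_integral_distr)
      (auto simp: measurable_cong_sets[OF S refl] r intro!: measurable_fin_PiM)
  also have "distr (run_measure M \<pi>) (?P {0..<n}) (\<lambda>\<omega>. restrict \<omega> {0..<n})
      = run.CI M \<pi> {0..<n}"
    by (rule run.distr_lim) simp
  also have "(\<integral>\<^sup>+\<omega>. indicator X (map \<omega> [0..<n]) \<partial>run.CI M \<pi> {0..<n})
      = (\<integral>\<^sup>+\<omega>. indicator X (map \<omega> [0..<n]) \<partial>run.C M \<pi> 0 n ?u)"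
    unfolding run.CI_def up
    by (subst nn_integral_distr) (auto simp: mC r intro!: measurable_restrict_subset measurable_fin_PiM)
  also have "\<dots> = emeasure (hist M \<pi> n) X"
    by (simp add: nn_integral_C_hist)
  finally show "emeasure (distr (run_measure M \<pi>) (count_space UNIV) (\<lambda>\<omega>. map \<omega> [0..<n])) X
      = emeasure (hist M \<pi> n) X" .
qed simp

lemma sets_run_measure:
  "sets (run_measure M \<pi>) = sets (PiM UNIV (\<lambda>_. count_space UNIV))"
  by (rule run.PF.sets_lim)

text \<open>The image of the run measure under the prefix of length 0 is a \<open>pmf\<close>, and
  images preserve total mass.\<close>

lemma prob_space_run_measure: "prob_space (run_measure M \<pi>)"
proof (rule prob_space_distrD)
  show "(\<lambda>\<omega>. map \<omega> [0..<0]) \<in> measurable (run_measure M \<pi>) (count_space UNIV)"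
    by (subst measurable_cong_sets[OF sets_run_measure refl]) (rule measurable_map_upt)
  show "prob_space (distr (run_measure M \<pi>) (count_space UNIV) (\<lambda>\<omega>. map \<omega> [0..<0]))"
    unfolding distr_run_measure by (rule measure_pmf.prob_space_axioms)
qed

section \<open>Prefixes of state paths\<close>

definition prefix_pmf :: "('s, 'a) mdp \<Rightarrow> ('s, 'a) policy \<Rightarrow> nat \<Rightarrow> 's list pmf" where
  "prefix_pmf M \<pi> n = map_pmf (\<lambda>l. init M # map snd l) (hist M \<pi> n)"

lemma sets_path_measure [measurable_cong, simp]:
  "sets (path_measure M \<pi>) = sets (PiM UNIV (\<lambda>_. count_space UNIV))"
  by (simp add: path_measure_def path_space_def)

lemma space_path_measure [simp]: "space (path_measure M \<pi>) = UNIV"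
  by (simp add: path_measure_def path_space_def space_PiM)

lemma measurable_states:
  "(\<lambda>\<omega>. case_nat s (\<lambda>t. snd (\<omega> t))) \<in> measurable (run_measure M \<pi>) path_space"
  unfolding path_space_def measurable_cong_sets[OF sets_run_measure refl]
proof (rule measurable_PiM_single')
  fix i :: nat
  show "(\<lambda>\<omega>. case_nat s (\<lambda>t. snd (\<omega> t)) i)
      \<in> measurable (PiM UNIV (\<lambda>_. count_space UNIV)) (count_space UNIV)"
  proof (cases i)
    case (Suc j)
    have "(\<lambda>\<omega>. snd (\<omega> j)) \<in> measurable (PiM UNIV (\<lambda>_. count_space UNIV)) (count_space UNIV)"
      by (rule measurable_compose[OF measurable_component_singleton[of j UNIV "\<lambda>_. count_space UNIV"]]) auto
    then show ?thesis using Suc by simp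
  qed simp
qed simp

lemma prob_space_path_measure: "prob_space (path_measure M \<pi>)"
proof -
  interpret run: prob_space "run_measure M \<pi>"
    by (rule prob_space_run_measure)
  show ?thesis
    unfolding path_measure_def by (rule run.prob_space_distr[OF measurable_states])
qed

text \<open>Here \<open>n\<close> counts transitions, so a prefix has \<open>n + 1\<close> states.
  Forgetting the actions commutes with cutting off, up to the index shift caused by
  \<open>init M\<close> at time 0.\<close>

lemma distr_path_measure_prefix:
  "distr (path_measure M \<pi>) (count_space UNIV) (\<lambda>p. map p [0..<Suc n]) = measure_pmf (prefix_pmf M \<pi> n)"
proof -
  have "map (case_nat (init M) (\<lambda>t. snd (\<omega> t))) [0..<Suc n] = init M # map snd (map \<omega> [0..<n])"
    for \<omega> :: "nat \<Rightarrow> 'b \<times> 'a"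
    by (simp add: upt_conv_Cons map_Suc_upt[symmetric] del: upt_Suc)
  then have "distr (path_measure M \<pi>) (count_space UNIV) (\<lambda>p. map p [0..<Suc n])
     = distr (distr (run_measure M \<pi>) (count_space UNIV) (\<lambda>\<omega>. map \<omega> [0..<n])) (count_space UNIV)
        (\<lambda>l. init M # map snd l)"
    unfolding path_measure_def
    by (subst (1 2) distr_distr)
       (auto simp: path_space_def comp_def measurable_map_upt
          measurable_states[unfolded path_space_def measurable_cong_sets[OF sets_run_measure refl]]
          measurable_cong_sets[OF sets_run_measure refl] simp del: upt_Suc)
  then show ?thesis
    by (simp add: distr_run_measure prefix_pmf_def map_pmf_rep_eq)
qed

lemma nn_integral_path_prefix:
  "(\<integral>\<^sup>+p. F (map p [0..<Suc n]) \<partial>path_measure M \<pi>) = (\<integral>\<^sup>+xs. F xs \<partial>prefix_pmf M \<pi> n)"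
proof -
  have "(\<integral>\<^sup>+xs. F xs \<partial>distr (path_measure M \<pi>) (count_space UNIV) (\<lambda>p. map p [0..<Suc n]))
      = (\<integral>\<^sup>+p. F (map p [0..<Suc n]) \<partial>path_measure M \<pi>)"
    by (subst nn_integral_distr)
      (auto simp: measurable_map_upt measurable_cong_sets[OF sets_path_measure refl] simp del: upt_Suc)
  then show ?thesis by (simp only: distr_path_measure_prefix)
qed

section \<open>Marginals at one time: states, state-action pairs, transitions\<close>

definition state_pmf :: "('s, 'a) mdp \<Rightarrow> ('s, 'a) policy \<Rightarrow> nat \<Rightarrow> 's pmf" where
  "state_pmf M \<pi> t = map_pmf (\<lambda>l. last_state (init M, l)) (hist M \<pi> t)"

definition act_pmf :: "('s, 'a) mdp \<Rightarrow> ('s, 'a) policy \<Rightarrow> nat \<Rightarrow> ('s \<times> 'a) pmf" where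
  "act_pmf M \<pi> t = bind_pmf (hist M \<pi> t)
    (\<lambda>l. map_pmf (Pair (last_state (init M, l))) (\<pi> (init M, l)))"

definition move_pmf :: "('s, 'a) mdp \<Rightarrow> ('s, 'a) policy \<Rightarrow> nat \<Rightarrow> ('s \<times> 's) pmf" where
  "move_pmf M \<pi> t = bind_pmf (act_pmf M \<pi> t) (\<lambda>(s, a). map_pmf (Pair s) (trans M s a))"

lemma length_hist: "l \<in> set_pmf (hist M \<pi> n) \<Longrightarrow> length l = n"
  by (induction n arbitrary: l) auto

lemma last_state_conv: "last_state (s, l) = (s # map snd l) ! length l"
  by (cases l rule: rev_cases) (auto simp: nth_append)

lemma move_pmf_prefix:
  "map_pmf (\<lambda>xs. (xs ! t, xs ! Suc t)) (prefix_pmf M \<pi> (Suc t)) = move_pmf M \<pi> t"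
proof -
  have "map_pmf (\<lambda>xs. (xs ! t, xs ! Suc t)) (prefix_pmf M \<pi> (Suc t))
      = bind_pmf (hist M \<pi> t) (\<lambda>l. map_pmf (\<lambda>x. (last_state (init M, l), snd x)) (step M \<pi> (init M, l)))"
    unfolding prefix_pmf_def hist.simps map_bind_pmf pmf.map_comp comp_def
    by (intro bind_pmf_cong refl map_pmf_cong)
      (auto dest!: length_hist simp: last_state_conv nth_append nth_Cons split: nat.splits)
  also have "\<dots> = move_pmf M \<pi> t"
    by (simp add: move_pmf_def act_pmf_def step_def map_bind_pmf bind_assoc_pmf bind_map_pmf
        map_pmf_def bind_return_pmf)
  finally show ?thesis .
qed

lemma distr_path_measure_move:
  "distr (path_measure M \<pi>) (count_space UNIV) (\<lambda>p. (p t, p (Suc t))) = measure_pmf (move_pmf M \<pi> t)"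
proof -
  have "distr (path_measure M \<pi>) (count_space UNIV) (\<lambda>p. (p t, p (Suc t)))
     = distr (distr (path_measure M \<pi>) (count_space UNIV) (\<lambda>p. map p [0..<Suc (Suc t)])) (count_space UNIV)
        (\<lambda>xs. (xs ! t, xs ! Suc t))"
    by (subst distr_distr)
      (auto simp: measurable_map_upt measurable_cong_sets[OF sets_path_measure refl] comp_def
        nth_append simp del: upt_Suc)
  also have "\<dots> = measure_pmf (move_pmf M \<pi> t)"
    by (simp add: distr_path_measure_prefix move_pmf_prefix[symmetric] map_pmf_rep_eq del: upt_Suc)
  finally show ?thesis .
qed

lemma map_fst_move_pmf: "map_pmf fst (move_pmf M \<pi> t) = state_pmf M \<pi> t"
  by (simp add: move_pmf_def act_pmf_def state_pmf_def map_bind_pmf bind_assoc_pmf bind_map_pmf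
      map_pmf_def bind_return_pmf case_prod_beta)

lemma map_fst_act_pmf: "map_pmf fst (act_pmf M \<pi> t) = state_pmf M \<pi> t"
  by (simp add: act_pmf_def state_pmf_def map_bind_pmf bind_assoc_pmf bind_map_pmf
      map_pmf_def bind_return_pmf)

lemma map_snd_move_pmf: "map_pmf snd (move_pmf M \<pi> t) = state_pmf M \<pi> (Suc t)"
  by (simp add: move_pmf_def act_pmf_def state_pmf_def step_def map_bind_pmf bind_assoc_pmf bind_map_pmf
      map_pmf_def bind_return_pmf case_prod_beta)

lemma pmf_map_fst: "pmf (map_pmf fst p) x = (\<Sum>y\<in>UNIV. pmf p (x, y :: 'b::finite))"
proof -
  have "fst -` {x} = Pair x ` (UNIV :: 'b set)" by auto
  then show ?thesis
    by (simp add: pmf_map measure_measure_pmf_finite sum.reindex inj_on_def)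
qed

lemma pmf_map_snd: "pmf (map_pmf snd p) y = (\<Sum>x\<in>UNIV. pmf p (x :: 'b::finite, y))"
proof -
  have "snd -` {y} = (\<lambda>x. (x, y)) ` (UNIV :: 'b set)" by auto
  then show ?thesis
    by (simp add: pmf_map measure_measure_pmf_finite sum.reindex inj_on_def)
qed

lemma pmf_map_Pair: "pmf (map_pmf (Pair x) p) (x', y) = (if x' = x then pmf p y else 0)"
proof (cases "x' = x")
  case True
  then show ?thesis by (simp add: pmf_map_inj' inj_on_def)
next
  case False
  then have "(x', y) \<notin> set_pmf (map_pmf (Pair x) p)" by auto
  with False show ?thesis by (simp add: pmf_eq_0_set_pmf)
qed

lemma sum_move_left:
  fixes M :: "('s::finite, 'a) mdp"
  shows "(\<Sum>q\<in>UNIV. pmf (move_pmf M \<pi> t) (s, q)) = pmf (state_pmf M \<pi> t) s"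
  by (simp add: map_fst_move_pmf[symmetric] pmf_map_fst)

lemma sum_move_right:
  fixes M :: "('s::finite, 'a) mdp"
  shows "(\<Sum>s\<in>UNIV. pmf (move_pmf M \<pi> t) (s, q)) = pmf (state_pmf M \<pi> (Suc t)) q"
  by (simp add: map_snd_move_pmf[symmetric] pmf_map_snd)

lemma sum_act:
  fixes M :: "('s, 'a::finite) mdp"
  shows "(\<Sum>a\<in>UNIV. pmf (act_pmf M \<pi> t) (s, a)) = pmf (state_pmf M \<pi> t) s"
  by (simp add: map_fst_act_pmf[symmetric] pmf_map_fst)

lemma sum_prod_UNIV:
  fixes f :: "'a::finite \<times> 'b::finite \<Rightarrow> real"
  shows "(\<Sum>x\<in>UNIV. f x) = (\<Sum>a\<in>UNIV. \<Sum>b\<in>UNIV. f (a, b))"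
  by (simp add: sum.cartesian_product UNIV_Times_UNIV)

text \<open>However much the policy remembers, the next state depends on the history only through
  the current state and action. Hence the flow between states is linear in the state-action
  frequencies.\<close>

lemma pmf_move:
  fixes M :: "('s::finite, 'a::finite) mdp"
  shows "pmf (move_pmf M \<pi> t) (s, q) = (\<Sum>a\<in>UNIV. pmf (act_pmf M \<pi> t) (s, a) * pmf (trans M s a) q)"
proof -
  have "pmf (move_pmf M \<pi> t) (s, q)
     = (\<Sum>x\<in>UNIV. pmf (act_pmf M \<pi> t) x * (if s = fst x then pmf (trans M (fst x) (snd x)) q else 0))"
    unfolding move_pmf_def pmf_bind
    by (subst integral_measure_pmf_real[of UNIV]) (auto simp: case_prod_beta pmf_map_Pair mult.commute)
  also have "\<dots> = (\<Sum>s'\<in>UNIV. if s = s' then \<Sum>a\<in>UNIV. pmf (act_pmf M \<pi> t) (s', a) * pmf (trans M s' a) q else 0)"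
    unfolding sum_prod_UNIV by (intro sum.cong refl) simp
  finally show ?thesis by simp
qed

lemma act_pmf_unavailable:
  assumes "\<pi> \<in> policies M" and "a \<notin> avail M s"
  shows "pmf (act_pmf M \<pi> t) (s, a) = 0"
  using assms by (auto simp: pmf_eq_0_set_pmf act_pmf_def policies_def)

lemma state_pmf_0: "state_pmf M \<pi> 0 = return_pmf (init M)"
  by (simp add: state_pmf_def)

lemma measurable_move:
  fixes M :: "('s::finite, 'a::finite) mdp"
  shows "(\<lambda>p. (p t, p (Suc t))) \<in> measurable (path_measure M \<pi>) (count_space UNIV)"
  unfolding measurable_cong_sets[OF sets_path_measure refl]
  using measurable_compose[OF measurable_map_upt[of "Suc (Suc t)"],
      of "\<lambda>xs. (xs ! t, xs ! Suc t)"]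
  by (simp add: nth_append del: upt_Suc)

lemma expectation_move:
  fixes M :: "('s::finite, 'a::finite) mdp" and \<phi> :: "'s \<Rightarrow> 's \<Rightarrow> real"
  shows "(\<integral>p. \<phi> (p t) (p (Suc t)) \<partial>path_measure M \<pi>)
      = (\<Sum>s\<in>UNIV. \<Sum>q\<in>UNIV. pmf (move_pmf M \<pi> t) (s, q) * \<phi> s q)" (is ?A)
    and "integrable (path_measure M \<pi>) (\<lambda>p. \<phi> (p t) (p (Suc t)))" (is ?B)
proof -
  let ?f = "\<lambda>p :: nat \<Rightarrow> 's. (p t, p (Suc t))"
  let ?\<phi> = "\<lambda>(x, y). \<phi> x y"
  note m = measurable_move[of t M \<pi>]
  have "integrable (measure_pmf (move_pmf M \<pi> t)) ?\<phi>"
    by (intro integrable_measure_pmf_finite) simp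
  then show ?B
    unfolding distr_path_measure_move[symmetric]
    by (subst (asm) integrable_distr_eq[OF m]) auto
  have "(\<integral>p. \<phi> (p t) (p (Suc t)) \<partial>path_measure M \<pi>) = (\<integral>x. ?\<phi> x \<partial>move_pmf M \<pi> t)"
    unfolding distr_path_measure_move[symmetric] by (subst integral_distr[OF m]) auto
  also have "\<dots> = (\<Sum>x\<in>UNIV. pmf (move_pmf M \<pi> t) x * ?\<phi> x)"
    by (subst integral_measure_pmf_real[of UNIV]) (auto simp: mult.commute)
  finally show ?A by (simp add: sum_prod_UNIV)
qed

text \<open>Transfers supports and absolute continuity between path laws and one-step
  kernels.\<close>

lemma AE_move:
  fixes M :: "('s::finite, 'a::finite) mdp"
  shows "(AE p in path_measure M \<pi>. \<Psi> (p t) (p (Suc t))) \<longleftrightarrow>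
    (\<forall>s q. pmf (move_pmf M \<pi> t) (s, q) > 0 \<longrightarrow> \<Psi> s q)"
proof -
  let ?f = "\<lambda>p :: nat \<Rightarrow> 's. (p t, p (Suc t))"
  note m = measurable_move[of t M \<pi>]
  have "(AE p in path_measure M \<pi>. \<Psi> (p t) (p (Suc t))) \<longleftrightarrow>
      (AE x in distr (path_measure M \<pi>) (count_space UNIV) ?f. \<Psi> (fst x) (snd x))"
    by (subst AE_distr_iff[OF m]) auto
  then show ?thesis
    unfolding distr_path_measure_move AE_measure_pmf_iff
    by (simp add: Ball_def split_paired_All pmf_positive_iff)
qed

lemma expectation_state:
  fixes M :: "('s::finite, 'a::finite) mdp" and \<phi> :: "'s \<Rightarrow> real"
  shows "(\<integral>p. \<phi> (p t) \<partial>path_measure M \<pi>) = (\<Sum>s\<in>UNIV. pmf (state_pmf M \<pi> t) s * \<phi> s)"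
    and "integrable (path_measure M \<pi>) (\<lambda>p. \<phi> (p t))"
  using expectation_move[where \<phi>="\<lambda>s q. \<phi> s" and t=t and M=M and \<pi>=\<pi>]
  by (simp_all add: sum_distrib_right[symmetric] sum_move_left)

section \<open>Stationary policies: the states form a Markov chain\<close>

lemma pmf_move_stationary:
  fixes M :: "('s::finite, 'a::finite) mdp"
  assumes "\<And>h. \<pi> h = \<mu> (last_state h)"
  shows "pmf (move_pmf M \<pi> t) (s, q) = pmf (state_pmf M \<pi> t) s * pmf (bind_pmf (\<mu> s) (trans M s)) q"
proof -
  define K where "K s = bind_pmf (\<mu> s) (trans M s)" for s
  have "move_pmf M \<pi> t = bind_pmf (state_pmf M \<pi> t) (\<lambda>s. map_pmf (Pair s) (K s))"
    by (simp add: assms K_def move_pmf_def act_pmf_def state_pmf_def map_bind_pmf bind_assoc_pmf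
        bind_map_pmf map_pmf_def bind_return_pmf)
  then have "pmf (move_pmf M \<pi> t) (s, q)
      = (\<Sum>s'\<in>UNIV. pmf (map_pmf (Pair s') (K s')) (s, q) * pmf (state_pmf M \<pi> t) s')"
    by (simp only: pmf_bind, subst integral_measure_pmf_real[of UNIV]) auto
  also have "\<dots> = (\<Sum>s'\<in>UNIV. if s = s' then pmf (K s') q * pmf (state_pmf M \<pi> t) s' else 0)"
    by (intro sum.cong refl) (simp add: pmf_map_Pair)
  finally show ?thesis by (simp add: K_def mult.commute)
qed

text \<open>A stationary decision uses only the last state, so the law of the state prefixes obeys a
  recursion from which the actions have disappeared.\<close>

lemma prefix_pmf_stationary:
  assumes "\<And>h. \<pi> h = \<mu> (last_state h)"
  shows "prefix_pmf M \<pi> 0 = return_pmf [init M]"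
    and "prefix_pmf M \<pi> (Suc n) = bind_pmf (prefix_pmf M \<pi> n)
      (\<lambda>xs. map_pmf (\<lambda>q. xs @ [q]) (bind_pmf (\<mu> (last xs)) (trans M (last xs))))"
proof -
  have l: "last_state (s, l) = last (s # map snd l)" for s l
    by (cases l rule: rev_cases) auto
  show "prefix_pmf M \<pi> (Suc n) = bind_pmf (prefix_pmf M \<pi> n)
      (\<lambda>xs. map_pmf (\<lambda>q. xs @ [q]) (bind_pmf (\<mu> (last xs)) (trans M (last xs))))"
    by (simp add: prefix_pmf_def map_bind_pmf bind_map_pmf pmf.map_comp comp_def assms step_def l
        del: last.simps, simp add: map_pmf_def bind_assoc_pmf bind_return_pmf)
qed (simp add: prefix_pmf_def)

subsection \<open>Maximal reachability\<close>

lemma pmf_eq_1_D: "pmf p x = 1 \<Longrightarrow> pmf p y = (if y = x then 1 else 0)"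
proof (cases "y = x")
  case False
  assume 1: "pmf p x = 1"
  have "pmf p x + pmf p y = measure p {x, y}"
    using False by (simp add: measure_measure_pmf_finite)
  also have "\<dots> \<le> 1" by simp
  finally show ?thesis using 1 False pmf_nonneg[of p y] by simp
qed simp

lemma absorbing_move:
  fixes M :: "('s::finite, 'a::finite) mdp"
  assumes "\<pi> \<in> policies M" "absorbing M s" "pmf (move_pmf M \<pi> t) (s, q) > 0"
  shows "q = s"
proof (rule ccontr)
  assume "q \<noteq> s"
  have "pmf (act_pmf M \<pi> t) (s, a) * pmf (trans M s a) q = 0" for a
  proof (cases "a \<in> avail M s")
    case True
    then have "pmf (trans M s a) s = 1" using assms(2) by (auto simp: absorbing_def)
    then show ?thesis using \<open>q \<noteq> s\<close> by (simp add: pmf_eq_1_D)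
  next
    case False
    then show ?thesis using act_pmf_unavailable[OF assms(1)] by simp
  qed
  then have "pmf (move_pmf M \<pi> t) (s, q) = 0"
    unfolding pmf_move by (intro sum.neutral) blast
  then show False using assms(3) by simp
qed

lemma path_measurable:
  fixes M :: "('s::finite, 'a::finite) mdp"
  shows "{p. \<Psi> (p t)} \<in> sets (path_measure M \<pi>)"
  using measurable_sets[OF measurable_component_singleton[of t UNIV "\<lambda>_. count_space (UNIV :: 's set)"],
      of "{s. \<Psi> s}"]
  by (simp add: vimage_def space_PiM)

lemma measure_path_state:
  fixes M :: "('s::finite, 'a::finite) mdp"
  shows "measure (path_measure M \<pi>) {p. p t \<in> B} = (\<Sum>s\<in>B. pmf (state_pmf M \<pi> t) s)"
proof -
  interpret prob_space "path_measure M \<pi>" by (rule prob_space_path_measure)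
  have "measure (path_measure M \<pi>) {p. p t \<in> B} = (\<integral>p. indicator {p. p t \<in> B} p \<partial>path_measure M \<pi>)"
    by (simp add: path_measurable)
  also have "\<dots> = (\<integral>p. indicator B (p t) \<partial>path_measure M \<pi>)"
    by (intro Bochner_Integration.integral_cong) (auto simp: indicator_def)
  also have "\<dots> = (\<Sum>s\<in>UNIV. pmf (state_pmf M \<pi> t) s * indicator B s)"
    by (rule expectation_state)
  also have "\<dots> = (\<Sum>s\<in>B. pmf (state_pmf M \<pi> t) s)"
    by (simp add: sum.inter_filter[symmetric] indicator_def if_distrib cong: if_cong)
  finally show ?thesis .
qed

text \<open>Since \<open>R\<close> is absorbing, up to a null set a path has visited
  \<open>R\<close> by time \<open>n\<close> exactly if it is in \<open>R\<close> at time
  \<open>n\<close>. Continuity from below gives the limit.\<close>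

lemma reach_prob_limit:
  fixes M :: "('s::finite, 'a::finite) mdp"
  assumes \<pi>: "\<pi> \<in> policies M" and R: "\<And>s. s \<in> R \<Longrightarrow> absorbing M s"
  shows "(\<lambda>n. \<Sum>s\<in>R. pmf (state_pmf M \<pi> n) s) \<longlonglongrightarrow> reach_prob M \<pi> R" (is ?A)
    and "(\<Sum>s\<in>R. pmf (state_pmf M \<pi> n) s) \<le> reach_prob M \<pi> R" (is ?B)
proof -
  interpret prob_space "path_measure M \<pi>" by (rule prob_space_path_measure)
  define B where "B n = {p. \<exists>t\<le>n. p t \<in> R}" for n :: nat
  have B: "B n \<in> events" for n
  proof -
    have "B n = (\<Union>t\<in>{..n}. {p. p t \<in> R})" by (auto simp: B_def)
    also have "\<dots> \<in> events" by (intro sets.finite_UN path_measurable) auto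
    finally show ?thesis .
  qed
  have inc: "incseq B" unfolding incseq_def B_def by (blast intro: order_trans)
  have U: "(\<Union>n. B n) = {p. \<exists>t. p t \<in> R}" by (auto simp: B_def)
  have "AE p in path_measure M \<pi>. \<forall>t. p t \<in> R \<longrightarrow> p (Suc t) \<in> R"
    unfolding AE_all_countable by (subst AE_move) (use absorbing_move[OF \<pi>] R in auto)
  then have "AE p in path_measure M \<pi>. p \<in> B n \<longleftrightarrow> p \<in> {p. p n \<in> R}" for n
  proof (rule AE_mp, intro AE_I2 impI)
    fix p :: "nat \<Rightarrow> 's" assume *: "\<forall>t. p t \<in> R \<longrightarrow> p (Suc t) \<in> R"
    have "p t \<in> R \<Longrightarrow> t \<le> n \<Longrightarrow> p n \<in> R" for t
      by (rotate_tac, induction n rule: dec_induct) (use * in auto)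
    then show "p \<in> B n \<longleftrightarrow> p \<in> {p. p n \<in> R}" by (auto simp: B_def)
  qed
  then have eq: "prob (B n) = (\<Sum>s\<in>R. pmf (state_pmf M \<pi> n) s)" for n
    unfolding measure_path_state[symmetric]
    by (rule measure_eq_AE) (fact | rule B path_measurable)+
  have rB: "range B \<subseteq> events" using B by blast
  show ?A
    using finite_Lim_measure_incseq[OF rB inc] unfolding eq U reach_prob_def .
  show ?B
    unfolding eq[symmetric] reach_prob_def U[symmetric]
    by (intro finite_measure_mono sets.countable_UN rB) auto
qed

lemma expectation_step:
  fixes M :: "('s::finite, 'a::finite) mdp" and \<phi> :: "'s \<Rightarrow> real"
  shows "(\<Sum>q\<in>UNIV. pmf (state_pmf M \<pi> (Suc t)) q * \<phi> q)
    = (\<Sum>s\<in>UNIV. \<Sum>q\<in>UNIV. pmf (move_pmf M \<pi> t) (s, q) * \<phi> q)"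
  by (subst sum.swap) (simp add: sum_move_right[symmetric] sum_distrib_right)

lemma sum_pmf_UNIV: "(\<Sum>x\<in>UNIV. pmf p (x :: 'b::finite)) = 1"
  by (rule sum_pmf_eq_1) auto

lemma policies_avail_nonempty:
  assumes "\<pi> \<in> policies M" shows "avail M s \<noteq> {}"
  using assms set_pmf_not_empty[of "\<pi> (s, [])"] by (force simp: policies_def)

lemma det_policy_in_policies:
  "(\<And>s. f s \<in> avail M s) \<Longrightarrow> (\<lambda>h. return_pmf (f (last_state h))) \<in> policies M"
  by (auto simp: policies_def)

section \<open>Discounted reachability and the limit of discount factor 1\<close>

context
  fixes M :: "('s::finite, 'a::finite) mdp" and R :: "'s set" and \<beta> :: real
begin

text \<open>Value iteration: for nonempty action sets, the largest expectation of \<beta>^\<tau> on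
  the event \<tau> \<le> n, with \<tau> the hitting time of \<open>R\<close>.\<close>

primrec discounted_value :: "nat \<Rightarrow> 's \<Rightarrow> real" where
  "discounted_value 0 s = indicator R s"
| "discounted_value (Suc n) s = (if s \<in> R then 1 else
    \<beta> * Max ((\<lambda>a. \<Sum>q\<in>UNIV. pmf (trans M s a) q * discounted_value n q) ` avail M s))"

end

text \<open>The value iterates increase and are bounded by 1. Their limit inherits the optimality
  equation, and \<open>f\<close> picks a greedy action, which exists because the action sets are
  finite and nonempty.\<close>

lemma bellman_solution:
  fixes M :: "('s::finite, 'a::finite) mdp"
  assumes ne: "\<And>s. avail M s \<noteq> {}" and \<beta>: "0 < \<beta>" "\<beta> < 1"
  obtains V f where "\<And>s. 0 \<le> V s" "\<And>s. V s \<le> (1::real)" "\<And>s. s \<in> R \<Longrightarrow> V s = 1"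
    "\<And>s a. s \<notin> R \<Longrightarrow> a \<in> avail M s \<Longrightarrow> \<beta> * (\<Sum>q\<in>UNIV. pmf (trans M s a) q * V q) \<le> V s"
    "\<And>s. f s \<in> avail M s"
    "\<And>s. s \<notin> R \<Longrightarrow> V s = \<beta> * (\<Sum>q\<in>UNIV. pmf (trans M s (f s)) q * V q)"
proof -
  let ?V = "discounted_value M R \<beta>"
  let ?E = "\<lambda>\<phi> s a. \<Sum>q\<in>UNIV. pmf (trans M s a) q * (\<phi> q :: real)"
  have E_mono: "?E \<phi> s a \<le> ?E \<psi> s a" if "\<And>q. \<phi> q \<le> \<psi> q" for \<phi> \<psi> s a
    by (intro sum_mono mult_left_mono that) auto
  have E_le_1: "?E \<phi> s a \<le> 1" if "\<And>q. \<phi> q \<le> 1" for \<phi> s a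
    using E_mono[of \<phi> "\<lambda>_. 1", OF that, of s a] by (simp add: sum_pmf_UNIV)
  have Max_mono: "Max ((\<lambda>a. ?E \<phi> s a) ` avail M s) \<le> Max ((\<lambda>a. ?E \<psi> s a) ` avail M s)"
    if "\<And>q. \<phi> q \<le> \<psi> q" for \<phi> \<psi> s
  proof -
    have "?E \<phi> s a \<le> Max ((\<lambda>a. ?E \<psi> s a) ` avail M s)" if "a \<in> avail M s" for a
      using E_mono[of \<phi> \<psi> s a, OF \<open>\<And>q. \<phi> q \<le> \<psi> q\<close>] that
      by (intro order_trans[OF _ Max_ge]) auto
    then show ?thesis using ne[of s] by (subst Max_le_iff) auto
  qed
  have V0: "0 \<le> ?V n s" for n s
  proof (induction n arbitrary: s)
    case (Suc n)
    obtain a where "a \<in> avail M s" using ne[of s] by blast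
    moreover have "0 \<le> ?E (?V n) s a" by (intro sum_nonneg mult_nonneg_nonneg Suc) auto
    ultimately have "0 \<le> Max ((\<lambda>a. ?E (?V n) s a) ` avail M s)" by (subst Max_ge_iff) auto
    then show ?case using \<beta> by simp
  qed simp
  have V1: "?V n s \<le> 1" for n s
  proof (induction n arbitrary: s)
    case (Suc n)
    have "Max ((\<lambda>a. ?E (?V n) s a) ` avail M s) \<le> 1"
      using ne[of s] E_le_1[OF Suc] by (subst Max_le_iff) auto
    then have "\<beta> * Max ((\<lambda>a. ?E (?V n) s a) ` avail M s) \<le> \<beta> * 1"
      using \<beta> by (intro mult_left_mono) auto
    also have "\<dots> \<le> 1" using \<beta> by simp
    finally show ?case by simp
  qed (simp add: indicator_def)
  have mono: "?V n s \<le> ?V (Suc n) s" for n s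
  proof (induction n arbitrary: s)
    case 0
    show ?case using V0[of "Suc 0" s] by (cases "s \<in> R") auto
  next
    case (Suc n)
    show ?case
      using Max_mono[of "?V n" "?V (Suc n)" s, OF Suc] \<beta>
      by (cases "s \<in> R") (auto simp del: discounted_value.simps(2) simp: discounted_value.simps(2)[of M R \<beta> "Suc n"]
          discounted_value.simps(2)[of M R \<beta> n s] intro!: mult_left_mono)
  qed
  have "\<exists>l. (\<lambda>n. ?V n s) \<longlonglongrightarrow> l \<and> (\<forall>n. ?V n s \<le> l)" for s
    using incseq_convergent[of "\<lambda>n. ?V n s" 1] V1 mono by (metis incseq_SucI)
  then obtain V where V: "\<And>s. (\<lambda>n. ?V n s) \<longlonglongrightarrow> V s" "\<And>n s. ?V n s \<le> V s" by metis
  have R1: "?V n s = 1" if "s \<in> R" for s n using that by (cases n) auto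
  have sup: "\<beta> * ?E V s a \<le> V s" if "s \<notin> R" "a \<in> avail M s" for s a
  proof (rule LIMSEQ_le)
    show "(\<lambda>n. \<beta> * ?E (?V n) s a) \<longlonglongrightarrow> \<beta> * ?E V s a"
      by (intro tendsto_intros V)
    show "(\<lambda>n. ?V (Suc n) s) \<longlonglongrightarrow> V s" using V(1) by (rule LIMSEQ_Suc)
    show "\<exists>N. \<forall>n\<ge>N. \<beta> * ?E (?V n) s a \<le> ?V (Suc n) s"
      using that \<beta> by (auto intro!: mult_left_mono)
  qed
  define f where "f s = (SOME a. a \<in> avail M s \<and> (\<forall>b\<in>avail M s. ?E V s b \<le> ?E V s a))" for s
  have f: "f s \<in> avail M s \<and> (\<forall>b\<in>avail M s. ?E V s b \<le> ?E V s (f s))" for s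
  proof -
    have "Max ((\<lambda>a. ?E V s a) ` avail M s) \<in> (\<lambda>a. ?E V s a) ` avail M s"
      using ne[of s] by (intro Max_in) auto
    then obtain a where a: "a \<in> avail M s" "?E V s a = Max ((\<lambda>a. ?E V s a) ` avail M s)" by auto
    then have "\<forall>b\<in>avail M s. ?E V s b \<le> ?E V s a" by simp
    with a show ?thesis unfolding f_def by (intro someI[where P="\<lambda>a. a \<in> avail M s \<and> (\<forall>b\<in>avail M s. ?E V s b \<le> ?E V s a)"]) auto
  qed
  \<comment> \<open>Every iterate lies below \<open>V\<close>, so its best one-step value is at most
    that of the greedy action for \<open>V\<close>; with \<open>sup\<close> this becomes
    equality.\<close>
  have le: "V s \<le> \<beta> * ?E V s (f s)" if s: "s \<notin> R" for s
  proof (rule LIMSEQ_le_const2)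
    show "(\<lambda>n. ?V (Suc n) s) \<longlonglongrightarrow> V s" using V(1) by (rule LIMSEQ_Suc)
    have "Max ((\<lambda>a. ?E (?V n) s a) ` avail M s) \<le> ?E V s (f s)" for n
      using ne[of s] f[of s] E_mono[of "?V n" V s, OF V(2)] by (subst Max_le_iff) (auto intro: order_trans)
    then show "\<exists>N. \<forall>n\<ge>N. ?V (Suc n) s \<le> \<beta> * ?E V s (f s)"
      using s \<beta> by (auto intro!: mult_left_mono)
  qed
  show thesis
  proof (rule that[of V f])
    show "0 \<le> V s" for s
      using V0[of 0 s] V(2)[of 0 s] by (rule order_trans)
    show "V s \<le> 1" for s
      using LIMSEQ_le_const2[OF V(1)[of s], of 1] V1 by blast
    show "V s = 1" if "s \<in> R" for s
      using V(1)[of s] LIMSEQ_unique[OF _ tendsto_const[of 1]] by (simp add: R1[OF that])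
    show "V s = \<beta> * ?E V s (f s)" if "s \<notin> R" for s
      using le[OF that] sup[OF that, of "f s"] f[of s] by simp
    show "f s \<in> avail M s" for s using f by simp
  qed (fact sup)
qed

text \<open>A verification argument. Under \<open>\<pi>\<close> the discounted \<open>V\<close>
  decreases in mean, so the left side is at most \<open>V (init M)\<close>; under the greedy policy
  \<open>V\<close> satisfies an equation whose iteration bounds \<open>V (init M)\<close> by the
  undiscounted reachability.\<close>

lemma discounted_reach_le:
  fixes M :: "('s::finite, 'a::finite) mdp"
  assumes \<pi>: "\<pi> \<in> policies M" and R: "\<And>s. s \<in> R \<Longrightarrow> absorbing M s" and \<beta>: "0 < \<beta>" "\<beta> < 1"
  shows "\<exists>f. (\<forall>s. f s \<in> avail M s) \<and>
    \<beta> ^ N * (\<Sum>s\<in>R. pmf (state_pmf M \<pi> N) s) \<le> reach_prob M (\<lambda>h. return_pmf (f (last_state h))) R"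
proof -
  obtain V f where V: "\<And>s. 0 \<le> V s" "\<And>s. V s \<le> (1::real)" "\<And>s. s \<in> R \<Longrightarrow> V s = 1"
    and sup: "\<And>s a. s \<notin> R \<Longrightarrow> a \<in> avail M s \<Longrightarrow> \<beta> * (\<Sum>q\<in>UNIV. pmf (trans M s a) q * V q) \<le> V s"
    and f: "\<And>s. f s \<in> avail M s"
      "\<And>s. s \<notin> R \<Longrightarrow> V s = \<beta> * (\<Sum>q\<in>UNIV. pmf (trans M s (f s)) q * V q)"
    by (rule bellman_solution[of M \<beta> R, OF policies_avail_nonempty[OF \<pi>] \<beta>]) (rule that)
  let ?\<pi> = "\<lambda>h. return_pmf (f (last_state h))"
  let ?E = "\<lambda>\<pi> t. \<Sum>s\<in>UNIV. pmf (state_pmf M \<pi> t) s * V s"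
  let ?\<rho> = "reach_prob M ?\<pi> R"
  have sup': "\<beta> * (\<Sum>q\<in>UNIV. pmf (trans M s a) q * V q) \<le> V s" if "a \<in> avail M s" for s a
  proof (cases "s \<in> R")
    case True
    have "(\<Sum>q\<in>UNIV. pmf (trans M s a) q * V q) \<le> (\<Sum>q\<in>UNIV. pmf (trans M s a) q * 1)"
      by (intro sum_mono mult_left_mono V) auto
    then show ?thesis
      using V(3)[OF True] \<beta> mult_mono[of \<beta> 1 "\<Sum>q\<in>UNIV. pmf (trans M s a) q * V q" 1] V(1)
      by (simp add: sum_pmf_UNIV sum_nonneg)
  qed (use sup that in auto)
  have dec: "\<beta> * ?E \<pi> (Suc t) \<le> ?E \<pi> t" for t
  proof -
    have "\<beta> * ?E \<pi> (Suc t) = (\<Sum>s\<in>UNIV. \<Sum>a\<in>UNIV. pmf (act_pmf M \<pi> t) (s, a) *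
        (\<beta> * (\<Sum>q\<in>UNIV. pmf (trans M s a) q * V q)))"
      unfolding expectation_step pmf_move
      by (simp add: sum_distrib_left sum_distrib_right mult_ac) (intro sum.cong refl sum.swap)
    also have "\<dots> \<le> (\<Sum>s\<in>UNIV. \<Sum>a\<in>UNIV. pmf (act_pmf M \<pi> t) (s, a) * V s)"
    proof (intro sum_mono)
      fix s a
      show "pmf (act_pmf M \<pi> t) (s, a) * (\<beta> * (\<Sum>q\<in>UNIV. pmf (trans M s a) q * V q))
          \<le> pmf (act_pmf M \<pi> t) (s, a) * V s"
        using sup'[of a s] act_pmf_unavailable[OF \<pi>, of a s]
        by (cases "a \<in> avail M s") (auto intro: mult_left_mono)
    qed
    also have "\<dots> = ?E \<pi> t"
      by (simp add: sum_distrib_right[symmetric] sum_act)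
    finally show ?thesis .
  qed
  have "\<beta> ^ N * ?E \<pi> N \<le> ?E \<pi> 0"
  proof (induction N)
    case (Suc N)
    have "\<beta> ^ Suc N * ?E \<pi> (Suc N) = \<beta> ^ N * (\<beta> * ?E \<pi> (Suc N))" by simp
    also have "\<dots> \<le> \<beta> ^ N * ?E \<pi> N" using \<beta> by (intro mult_left_mono dec) auto
    finally show ?case using Suc by simp
  qed simp
  moreover have "(\<Sum>s\<in>R. pmf (state_pmf M \<pi> N) s) \<le> ?E \<pi> N"
  proof -
    have "(\<Sum>s\<in>R. pmf (state_pmf M \<pi> N) s) = (\<Sum>s\<in>R. pmf (state_pmf M \<pi> N) s * V s)"
      by (intro sum.cong) (auto simp: V)
    also have "\<dots> \<le> ?E \<pi> N" by (intro sum_mono2) (auto simp: V)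
    finally show ?thesis .
  qed
  ultimately have 1: "\<beta> ^ N * (\<Sum>s\<in>R. pmf (state_pmf M \<pi> N) s) \<le> V (init M)"
    using \<beta> by (simp add: state_pmf_0 indicator_def order_trans[OF mult_left_mono])
  have pol: "?\<pi> \<in> policies M" by (intro det_policy_in_policies f)
  \<comment> \<open>On \<open>R\<close> both \<open>V\<close> and its average equal 1, and writing 1
    as (1 - \<beta>) + \<beta> gives one equation for all states.\<close>
  have eqR: "V s = (1 - \<beta>) * indicator R s + \<beta> * (\<Sum>q\<in>UNIV. pmf (trans M s (f s)) q * V q)" for s
  proof (cases "s \<in> R")
    case True
    then have "pmf (trans M s (f s)) s = 1" using R f by (auto simp: absorbing_def)
    then have "pmf (trans M s (f s)) q * V q = (if q = s then V s else 0)" for q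
      by (simp add: pmf_eq_1_D)
    then have "(\<Sum>q\<in>UNIV. pmf (trans M s (f s)) q * V q) = V s" by simp
    then show ?thesis using True V(3)[OF True] by simp
  qed (use f in auto)
  have step: "?E ?\<pi> t \<le> (1 - \<beta>) * ?\<rho> + \<beta> * ?E ?\<pi> (Suc t)" for t
  proof -
    have "?E ?\<pi> t = (\<Sum>s\<in>UNIV. (1 - \<beta>) * (pmf (state_pmf M ?\<pi> t) s * indicator R s)
        + \<beta> * (pmf (state_pmf M ?\<pi> t) s * (\<Sum>q\<in>UNIV. pmf (trans M s (f s)) q * V q)))"
      by (intro sum.cong refl) (subst eqR, simp add: algebra_simps)
    also have "\<dots> = (1 - \<beta>) * (\<Sum>s\<in>R. pmf (state_pmf M ?\<pi> t) s) + \<beta> * ?E ?\<pi> (Suc t)"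
      unfolding expectation_step
      by (subst pmf_move_stationary[where \<mu>="\<lambda>s. return_pmf (f s)"])
        (auto simp: sum.distrib sum_distrib_left[symmetric] bind_return_pmf mult.assoc
          sum.inter_filter[symmetric] indicator_def if_distrib cong: if_cong)
    also have "\<dots> \<le> (1 - \<beta>) * ?\<rho> + \<beta> * ?E ?\<pi> (Suc t)"
      using \<beta> by (intro add_mono mult_left_mono reach_prob_limit pol R) auto
    finally show ?thesis .
  qed
  \<comment> \<open>Iterating \<open>step\<close> adds up the geometric weights (1 - \<beta>)
    \<beta>^t to 1 - \<beta>^n.\<close>
  have "?E ?\<pi> 0 \<le> (1 - \<beta> ^ n) * ?\<rho> + \<beta> ^ n * ?E ?\<pi> n" for n
  proof (induction n)
    case (Suc n)
    have "\<beta> ^ n * ?E ?\<pi> n \<le> \<beta> ^ n * ((1 - \<beta>) * ?\<rho> + \<beta> * ?E ?\<pi> (Suc n))"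
      using \<beta> by (intro mult_left_mono step) auto
    with Suc show ?case by (simp add: algebra_simps)
  qed simp
  moreover have "?E ?\<pi> n \<le> 1" for n
  proof -
    have "?E ?\<pi> n \<le> (\<Sum>s\<in>UNIV. pmf (state_pmf M ?\<pi> n) s * 1)"
      by (intro sum_mono mult_left_mono V) auto
    then show ?thesis by (simp add: sum_pmf_UNIV)
  qed
  ultimately have le: "?E ?\<pi> 0 \<le> (1 - \<beta> ^ n) * ?\<rho> + \<beta> ^ n * 1" for n
    using \<beta> by (meson add_left_mono mult_left_mono order_trans zero_le_power less_imp_le)
  have "(\<lambda>n. (1 - \<beta> ^ n) * ?\<rho> + \<beta> ^ n * 1) \<longlonglongrightarrow> (1 - 0) * ?\<rho> + 0 * 1"
    using \<beta> by (intro tendsto_intros LIMSEQ_power_zero) auto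
  then have "?E ?\<pi> 0 \<le> ?\<rho>"
    using le by (intro LIMSEQ_le_const[of _ ?\<rho>]) auto
  then have "V (init M) \<le> ?\<rho>" by (simp add: state_pmf_0 indicator_def)
  with 1 f show ?thesis by (intro exI[of _ f]) auto
qed

text \<open>There are finitely many deterministic stationary policies, so their best reachability
  \<open>m\<close> bounds the discounted values for all \<beta> at once, although the greedy policy
  may vary with \<beta>. First \<beta> tends to 1 with \<open>N\<close> fixed, then \<open>N\<close>
  to infinity.\<close>

lemma stationary_maximizes_reach:
  fixes M :: "('s::finite, 'a::finite) mdp"
  assumes \<pi>: "\<pi> \<in> policies M" and R: "\<And>s. s \<in> R \<Longrightarrow> absorbing M s"
  shows "\<exists>\<pi>'\<in>policies M. stationary \<pi>' \<and> reach_prob M \<pi> R \<le> reach_prob M \<pi>' R"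
proof -
  let ?d = "\<lambda>f h. return_pmf (f (last_state h)) :: 'a pmf"
  let ?F = "{f. \<forall>s. f s \<in> avail M s}"
  let ?r = "\<lambda>n. \<Sum>s\<in>R. pmf (state_pmf M \<pi> n) s"
  define m where "m = Max ((\<lambda>f. reach_prob M (?d f) R) ` ?F)"
  have "(\<lambda>s. SOME a. a \<in> avail M s) \<in> ?F"
    using policies_avail_nonempty[OF \<pi>] by (simp add: some_in_eq)
  then have "m \<in> (\<lambda>f. reach_prob M (?d f) R) ` ?F"
    unfolding m_def by (intro Max_in) auto
  then obtain f where f: "f \<in> ?F" "m = reach_prob M (?d f) R" by auto
  have le: "\<beta> ^ N * ?r N \<le> m" if \<beta>: "0 < \<beta>" "\<beta> < 1" for N \<beta>
  proof -
    obtain g where "g \<in> ?F" "\<beta> ^ N * ?r N \<le> reach_prob M (?d g) R"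
      using discounted_reach_le[OF \<pi> R \<beta>, where N=N] by auto
    moreover from this have "reach_prob M (?d g) R \<le> m"
      unfolding m_def by (intro Max_ge) auto
    ultimately show ?thesis by simp
  qed
  have "?r N \<le> m" for N
  proof (rule LIMSEQ_le_const2)
    \<comment> \<open>The discount factors 1 - 1/(k + 2) lie strictly between 0 and 1 already for k
      = 0.\<close>
    have "(\<lambda>k. (1 - inverse (real (Suc (Suc k)))) ^ N * ?r N) \<longlonglongrightarrow> (1 - 0) ^ N * ?r N"
      by (intro tendsto_intros LIMSEQ_Suc[OF LIMSEQ_inverse_real_of_nat])
    then show "(\<lambda>k. (1 - inverse (real (Suc (Suc k)))) ^ N * ?r N) \<longlonglongrightarrow> ?r N" by simp
    have "(1 - inverse (real (Suc (Suc k)))) ^ N * ?r N \<le> m" for k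
      by (rule le) (auto simp: field_simps)
    then show "\<exists>K. \<forall>k\<ge>K. (1 - inverse (real (Suc (Suc k)))) ^ N * ?r N \<le> m" by blast
  qed
  then have "reach_prob M \<pi> R \<le> m"
    by (intro LIMSEQ_le_const2[OF reach_prob_limit(1)[OF \<pi> R]]) auto
  moreover have "?d f \<in> policies M" using f by (intro det_policy_in_policies) auto
  moreover have "stationary (?d f)" by (auto simp: stationary_def)
  ultimately show ?thesis using f by auto
qed

subsection \<open>Variational bounds for the divergence\<close>

text \<open>The Donsker-Varadhan inequality in multiplicative form. With \<open>D\<close> the
  density of \<open>A\<close>, one has ln W - ln D \<le> W/D - 1, and the \<open>A\<close>-mean of
  W/D is at most the \<open>P\<close>-mean of W.\<close>

lemma gibbs_variational:
  assumes P: "prob_space P" and A: "prob_space A" and sets: "sets A = sets P"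
    and ac: "absolutely_continuous P A" and int: "integrable A (entropy_density (exp 1) P A)"
    and W: "W \<in> borel_measurable P" "\<And>x. 0 \<le> W x" "(\<integral>\<^sup>+x. ennreal (W x) \<partial>P) \<le> 1"
    and pos: "AE x in A. 0 < W x" and int_W: "integrable A (\<lambda>x. ln (W x))"
  shows "(\<integral>x. ln (W x) \<partial>A) \<le> KL_divergence (exp 1) P A"
proof -
  interpret P: prob_space P by fact
  interpret A: prob_space A by fact
  have fm: "finite_measure A" by unfold_locales
  obtain D where D:
      "D \<in> borel_measurable P" "AE x in P. RN_deriv P A x = ennreal (D x)"
      "AE x in A. 0 < D x" "\<And>x. 0 \<le> D x"
    by (rule P.real_RN_deriv[OF fm ac sets]) (rule that)
  note [measurable_cong] = sets
  note [measurable] = D(1) W(1)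
  have A_eq: "A = density P D"
    using D(2) by (subst P.density_RN_deriv[OF ac sets, symmetric]) (intro density_cong, auto)
  have ed: "AE x in A. entropy_density (exp 1) P A x = ln (D x)"
    using absolutely_continuous_AE[OF sets ac D(2)] D(3)
    by eventually_elim (simp add: entropy_density_def log_def)
  have int_D: "integrable A (\<lambda>x. ln (D x))"
    using int by (rule integrable_cong_AE_imp) (use ed in auto)
  have KL: "KL_divergence (exp 1) P A = (\<integral>x. ln (D x) \<partial>A)"
    unfolding KL_divergence_def
    by (rule integral_cong_AE) (use ed in \<open>auto simp: measurable_cong_sets[OF sets refl]\<close>)
  have "(\<integral>\<^sup>+x. ennreal (W x / D x) \<partial>A) = (\<integral>\<^sup>+x. ennreal (D x) * ennreal (W x / D x) \<partial>P)"
    by (subst A_eq, subst nn_integral_density) auto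
  \<comment> \<open>Only an inequality: where \<open>D\<close> is 0 the left integrand vanishes,
    while \<open>W\<close> may be positive.\<close>
  also have "\<dots> \<le> (\<integral>\<^sup>+x. ennreal (W x) \<partial>P)"
    by (intro nn_integral_mono) (auto simp: ennreal_mult[symmetric] D W(2) intro!: ennreal_leI)
  also note W(3)
  finally have le: "(\<integral>\<^sup>+x. ennreal (W x / D x) \<partial>A) \<le> 1" .
  have int_WD: "integrable A (\<lambda>x. W x / D x)"
    by (rule integrableI_nonneg) (use le in \<open>auto simp: D W(2) intro: le_less_trans\<close>)
  have "(\<integral>x. ln (W x) \<partial>A) - (\<integral>x. ln (D x) \<partial>A) = (\<integral>x. ln (W x) - ln (D x) \<partial>A)"
    using int_W int_D by simp
  also have "\<dots> \<le> (\<integral>x. W x / D x - 1 \<partial>A)"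
  proof (rule integral_mono_AE)
    show "AE x in A. ln (W x) - ln (D x) \<le> W x / D x - 1"
      using pos D(3)
    proof eventually_elim
      case (elim x)
      then show ?case using ln_le_minus_one[of "W x / D x"] by (simp add: ln_div)
    qed
  qed (use int_W int_D int_WD in auto)
  also have "\<dots> = enn2real (\<integral>\<^sup>+x. ennreal (W x / D x) \<partial>A) - 1"
    using int_WD by (simp add: A.prob_space integral_eq_nn_integral D W(2))
  also have "\<dots> \<le> 0" using enn2real_mono[OF le] by simp
  finally show ?thesis by (simp add: KL)
qed

text \<open>The exponential form is demanded only \<open>Q\<close>-almost everywhere, so
  \<open>L\<close> may vanish on a set of positive \<open>P\<close>-measure. Uniqueness of the
  Radon-Nikodym derivative identifies \<open>L\<close>.\<close>

lemma KL_density_exp: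
  assumes P: "prob_space P" and Q: "Q = density P L" and L: "L \<in> borel_measurable P"
    and eq: "AE x in Q. L x = ennreal (exp (\<l> x))" and int: "integrable Q \<l>"
  shows "KL Q P = ereal (\<integral>x. \<l> x \<partial>Q)"
proof -
  interpret P: prob_space P by fact
  have sets: "sets Q = sets P" by (simp add: Q)
  have ac: "absolutely_continuous P Q"
    unfolding Q by (rule absolutely_continuousI_density[OF L])
  have "AE x in P. L x = RN_deriv P Q x"
    using L Q by (intro P.RN_deriv_unique) auto
  then have "AE x in Q. L x = RN_deriv P Q x"
    by (rule absolutely_continuous_AE[OF sets ac])
  then have ed: "AE x in Q. \<l> x = entropy_density (exp 1) P Q x"
    using eq
  proof eventually_elim
    case (elim x)
    then have "enn2real (RN_deriv P Q x) = exp (\<l> x)"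
      by (metis enn2real_ennreal exp_ge_zero)
    then show ?case by (simp add: entropy_density_def log_def)
  qed
  have m: "entropy_density (exp 1) P Q \<in> borel_measurable Q"
    by (simp add: measurable_cong_sets[OF sets refl])
  have "integrable Q (entropy_density (exp 1) P Q)"
    using int m ed by (rule integrable_cong_AE_imp)
  moreover have "KL_divergence (exp 1) P Q = (\<integral>x. \<l> x \<partial>Q)"
    unfolding KL_divergence_def
    using ed by (intro integral_cong_AE m) (use int in auto)
  ultimately show ?thesis using ac by (simp add: KL_def)
qed

subsection \<open>Absorbing kernels and flows\<close>

text \<open>The Markov operator of \<open>K\<close>; its powers \<open>avg K ^^ n\<close> are
  expectations after \<open>n\<close> steps.\<close>

definition avg :: "('s::finite \<Rightarrow> 's pmf) \<Rightarrow> ('s \<Rightarrow> real) \<Rightarrow> 's \<Rightarrow> real" where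
  "avg K \<phi> s = (\<Sum>q\<in>UNIV. pmf (K s) q * \<phi> q)"

lemma avg_mono: "(\<And>q. pmf (K s) q > 0 \<Longrightarrow> \<phi> q \<le> \<psi> q) \<Longrightarrow> avg K \<phi> s \<le> avg K \<psi> s"
  unfolding avg_def
proof (rule sum_mono)
  fix q assume "\<And>q. pmf (K s) q > 0 \<Longrightarrow> \<phi> q \<le> \<psi> q"
  then show "pmf (K s) q * \<phi> q \<le> pmf (K s) q * \<psi> q"
    by (cases "pmf (K s) q = 0") (auto simp: less_le intro: mult_left_mono)
qed

lemma avg_const: "(\<And>q. pmf (K s) q > 0 \<Longrightarrow> \<phi> q = c) \<Longrightarrow> avg K \<phi> s = c"
proof -
  assume *: "\<And>q. pmf (K s) q > 0 \<Longrightarrow> \<phi> q = c"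
  have "avg K \<phi> s = (\<Sum>q\<in>UNIV. pmf (K s) q * c)"
    unfolding avg_def
  proof (rule sum.cong[OF refl])
    fix q show "pmf (K s) q * \<phi> q = pmf (K s) q * c"
      using *[of q] by (cases "pmf (K s) q = 0") (auto simp: less_le)
  qed
  then show ?thesis by (simp add: sum_distrib_right[symmetric] sum_pmf_UNIV)
qed

lemma avg_add: "avg K (\<lambda>q. \<phi> q + \<psi> q) s = avg K \<phi> s + avg K \<psi> s"
  by (simp add: avg_def sum.distrib distrib_left)

lemma avg_sum: "avg K (\<lambda>q. \<Sum>i\<in>I. \<phi> i q) s = (\<Sum>i\<in>I. avg K (\<phi> i) s)"
  unfolding avg_def by (simp add: sum_distrib_left) (rule sum.swap)

text \<open>A chain started in \<open>B\<close> stays there, so the values of \<open>\<phi>\<close>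
  elsewhere never enter.\<close>

lemma avg_funpow_closed:
  assumes closed: "\<And>s q. s \<in> B \<Longrightarrow> pmf (K s) q > 0 \<Longrightarrow> q \<in> B"
    and c: "\<And>s. s \<in> B \<Longrightarrow> \<phi> s = c" and s: "s \<in> B"
  shows "(avg K ^^ n) \<phi> s = c"
  using s
proof (induction n arbitrary: s)
  case (Suc n)
  then show ?case by (auto intro!: avg_const Suc.IH dest: closed)
qed (simp add: c)

section \<open>Absorbing targets: the transient set and a Lyapunov function\<close>

locale absorbing_kernel =
  fixes K :: "'s::finite \<Rightarrow> 's pmf" and R :: "'s set"
  assumes absorb: "\<And>s. s \<in> R \<Longrightarrow> K s = return_pmf s"
begin

abbreviation hit :: "nat \<Rightarrow> 's \<Rightarrow> real" where
  "hit n \<equiv> (avg K ^^ n) (indicator R)"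

text \<open>The complement consists of \<open>R\<close> and of the states from which
  \<open>R\<close> is out of reach; both parts are closed under \<open>K\<close>.\<close>

definition unresolved :: "'s set" where
  "unresolved = {s. s \<notin> R \<and> (\<exists>n. hit n s > 0)}"

lemma hit_R: "s \<in> R \<Longrightarrow> hit n s = 1"
  by (rule avg_funpow_closed[where B=R]) (auto simp: absorb indicator_def split: if_splits)

lemma hit_nonneg: "0 \<le> hit n s"
proof (induction n arbitrary: s)
  case (Suc n)
  then show ?case by (auto simp: avg_def intro!: sum_nonneg mult_nonneg_nonneg)
qed simp

lemma hit_le_1: "hit n s \<le> 1"
proof (induction n arbitrary: s)
  case (Suc n)
  then show ?case using avg_mono[of K s "hit n" "\<lambda>_. 1"] avg_const[of K s "\<lambda>_. 1"] by simp
qed (simp add: indicator_def)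

lemma hit_Suc: "hit n s \<le> hit (Suc n) s"
proof (induction n arbitrary: s)
  case 0
  show ?case
    using hit_R[of s "Suc 0"] hit_nonneg[of "Suc 0" s] by (cases "s \<in> R") auto
next
  case (Suc n)
  show ?case using avg_mono[of K s "hit n" "hit (Suc n)"] Suc by simp
qed

lemma hit_mono: "m \<le> n \<Longrightarrow> hit m s \<le> hit n s"
  using hit_Suc by (rule lift_Suc_mono_le)

lemma not_unresolved: "s \<notin> unresolved \<Longrightarrow> s \<notin> R \<Longrightarrow> hit n s = 0"
  using hit_nonneg[of n s] by (auto simp: unresolved_def less_le)

text \<open>A vanishing average of nonnegative terms vanishes at each successor, so states that
  cannot reach \<open>R\<close> lead only to such states.\<close>

lemma avoid_closed:
  assumes s: "s \<notin> unresolved" "s \<notin> R" and q: "pmf (K s) q > 0"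
  shows "q \<notin> unresolved" and "q \<notin> R"
proof -
  have 0: "hit n q = 0" for n
  proof -
    have "(\<Sum>q\<in>UNIV. pmf (K s) q * hit n q) = 0"
      using not_unresolved[OF s, of "Suc n"] by (simp add: avg_def)
    then have "\<forall>q\<in>UNIV. pmf (K s) q * hit n q = 0"
      by (subst (asm) sum_nonneg_eq_0_iff) (auto intro: mult_nonneg_nonneg hit_nonneg)
    then have "pmf (K s) q * hit n q = 0" by blast
    then show ?thesis using q by simp
  qed
  show "q \<notin> unresolved" using 0 by (simp add: unresolved_def)
  show "q \<notin> R" using 0[of 0] by auto
qed

lemma resolved_closed:
  assumes "s \<notin> unresolved" "pmf (K s) q > 0" shows "q \<notin> unresolved"
proof (cases "s \<in> R")
  case True
  then show ?thesis using assms absorb[OF True] by (auto simp: indicator_def split: if_splits)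
next
  case False
  then show ?thesis by (rule avoid_closed(1)[OF assms(1) _ assms(2)])
qed

text \<open>Take \<open>u\<close> to be 1 plus the expected time spent in T during the first
  \<open>N\<close> steps. Averaging shifts the sum by one: on T it removes 1 and adds the
  probability of still being in T after \<open>N\<close> steps, which is at most 1 - \<rho>. As
  \<open>u\<close> is bounded, the additive drift \<rho> becomes a factor \<kappa>.\<close>

lemma lyapunov:
  obtains u \<kappa> where "0 < \<kappa>" "\<kappa> < (1::real)" "\<And>s. 1 \<le> u s"
    "\<And>s. s \<in> unresolved \<Longrightarrow> avg K u s \<le> \<kappa> * u s"
    "\<And>s. s \<notin> unresolved \<Longrightarrow> avg K u s \<le> u s"
proof -
  let ?T = unresolved
  have "\<forall>s. \<exists>n. s \<in> ?T \<longrightarrow> hit n s > 0" by (auto simp: unresolved_def)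
  then obtain f where f: "\<And>s. s \<in> ?T \<Longrightarrow> hit (f s) s > 0" by metis
  \<comment> \<open>One horizon serves all states, as \<open>hit\<close> grows with
    \<open>n\<close>; below, \<open>insert 1\<close> covers an empty T and gives \<rho> \<le>
    1.\<close>
  define N where "N = Max (range f)"
  define \<rho> where "\<rho> = Min (insert 1 ((\<lambda>s. hit N s) ` ?T))"
  have pos: "0 < hit N s" if "s \<in> ?T" for s
    using f[OF that] hit_mono[of "f s" N s] by (auto simp: N_def)
  have \<rho>: "0 < \<rho>" "\<rho> \<le> 1" unfolding \<rho>_def by (auto simp: pos)
  have \<rho>_le: "\<rho> \<le> hit N s" if "s \<in> ?T" for s unfolding \<rho>_def using that by (intro Min_le) auto
  let ?a = "\<lambda>n. (avg K ^^ n) (indicator ?T)"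
  have a_nonneg: "0 \<le> ?a n s" for n s
  proof (induction n arbitrary: s)
    case (Suc n)
    then show ?case by (auto simp: avg_def intro!: sum_nonneg mult_nonneg_nonneg)
  qed simp
  have a_hit: "?a n s + hit n s \<le> 1" for n s
  proof (induction n arbitrary: s)
    case 0
    then show ?case by (auto simp: indicator_def unresolved_def)
  next
    case (Suc n)
    have "?a (Suc n) s + hit (Suc n) s = avg K (\<lambda>q. ?a n q + hit n q) s" by (simp add: avg_add)
    also have "\<dots> \<le> avg K (\<lambda>_. 1) s" by (intro avg_mono Suc)
    also have "\<dots> = 1" by (rule avg_const) simp
    finally show ?case .
  qed
  have a_off: "?a n s = 0" if "s \<notin> ?T" for s n
    by (rule avg_funpow_closed[where B="- ?T"]) (use that in \<open>auto dest: resolved_closed\<close>)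
  define u where "u s = 1 + (\<Sum>n<N. ?a n s)" for s
  \<comment> \<open>Although \<open>u\<close> is at most N + 1, the denominator is N + 2, which
    keeps \<kappa> positive even if N = 0 and \<rho> = 1.\<close>
  define \<kappa> where "\<kappa> = 1 - \<rho> / (2 + real N)"
  have avg_u: "avg K u s = 1 + (\<Sum>n<N. ?a (Suc n) s)" for s
    unfolding u_def avg_add avg_sum by (simp add: avg_const[where c=1])
  have shift: "(\<Sum>n<N. ?a (Suc n) s) = (\<Sum>n<N. ?a n s) - ?a 0 s + ?a N s" for s
    using sum_lessThan_telescope[of "\<lambda>n. ?a n s" N] by (simp add: sum_subtractf)
  show thesis
  proof (rule that[of \<kappa> u])
    show "0 < \<kappa>" using \<rho> by (simp add: \<kappa>_def field_simps)
    show "\<kappa> < 1" using \<rho> by (simp add: \<kappa>_def field_simps)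
    show "1 \<le> u s" for s unfolding u_def using a_nonneg by (simp add: sum_nonneg)
    show "avg K u s \<le> u s" if "s \<notin> ?T" for s
      unfolding avg_u u_def using a_off[OF that] by (simp del: funpow.simps)
    show "avg K u s \<le> \<kappa> * u s" if T: "s \<in> ?T" for s
    proof -
      have "?a n s \<le> 1" for n using a_hit[of n s] hit_nonneg[of n s] by linarith
      then have "(\<Sum>n<N. ?a n s) \<le> (\<Sum>n<N. 1)" by (intro sum_mono)
      then have "u s \<le> 2 + real N" by (simp add: u_def)
      then have "\<rho> * u s \<le> \<rho> * (2 + real N)" using \<rho> by (intro mult_left_mono) auto
      then have "\<rho> / (2 + real N) * u s \<le> \<rho>" by (simp add: field_simps)
      moreover have "avg K u s \<le> u s - \<rho>"
        unfolding avg_u shift u_def using T a_hit[of N s] \<rho>_le[OF T] by simp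
      ultimately show ?thesis by (simp add: \<kappa>_def left_diff_distrib)
    qed
  qed
qed

end

text \<open>The state flow of a process with arbitrary memory: \<open>p\<close> is its law over
  time, \<open>J\<close> its flow along edges. Only the total over time, and only out of T, has to
  follow the kernel \<open>Q\<close>; this is the balance equation for \<open>x\<close>.\<close>

locale flow =
  fixes p :: "nat \<Rightarrow> 's::finite \<Rightarrow> real" and J :: "nat \<Rightarrow> 's \<Rightarrow> 's \<Rightarrow> real" and s0 :: 's
    and T :: "'s set" and x :: "'s \<Rightarrow> real" and Q :: "'s \<Rightarrow> 's pmf"
  assumes J_nonneg: "\<And>t s q. 0 \<le> J t s q"
    and outflow: "\<And>t s. (\<Sum>q\<in>UNIV. J t s q) = p t s"
    and inflow: "\<And>t q. (\<Sum>s\<in>UNIV. J t s q) = p (Suc t) q"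
    and start: "\<And>s. p 0 s = (if s = s0 then 1 else 0)"
    and visits: "\<And>s. s \<in> T \<Longrightarrow> (\<lambda>t. p t s) sums x s"
    and moves: "\<And>s q. s \<in> T \<Longrightarrow> (\<lambda>t. J t s q) sums (x s * pmf (Q s) q)"
begin

lemma p_nonneg: "0 \<le> p t s"
  unfolding outflow[symmetric] by (intro sum_nonneg J_nonneg)

lemma x_nonneg: "s \<in> T \<Longrightarrow> 0 \<le> x s"
  by (rule sums_le[OF p_nonneg sums_zero visits])

lemma p_tendsto_0: "s \<in> T \<Longrightarrow> (\<lambda>t. p t s) \<longlonglongrightarrow> 0"
  using visits by (intro summable_LIMSEQ_zero) (auto simp: sums_iff)

text \<open>The balance equations tested against \<open>\<phi>\<close>: the mean of
  \<open>\<phi>\<close> changes only through moves out of states of T, and summing these changes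
  over time turns \<open>J\<close> into x(s) Q(s,q).\<close>

lemma potential_limit:
  assumes harm: "\<And>t s q. s \<notin> T \<Longrightarrow> J t s q > 0 \<Longrightarrow> \<phi> q = \<phi> s"
  shows "(\<lambda>n. \<Sum>s\<in>UNIV. p n s * \<phi> s) \<longlonglongrightarrow> \<phi> s0 + (\<Sum>s\<in>T. x s * (avg Q \<phi> s - \<phi> s))"
proof -
  let ?e = "\<lambda>n. \<Sum>s\<in>UNIV. p n s * \<phi> s"
  let ?d = "\<lambda>t. \<Sum>s\<in>T. \<Sum>q\<in>UNIV. J t s q * (\<phi> q - \<phi> s)"
  have diff: "?e (Suc t) - ?e t = ?d t" for t
  proof -
    have "?e (Suc t) = (\<Sum>s\<in>UNIV. \<Sum>q\<in>UNIV. J t s q * \<phi> q)"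
      by (subst sum.swap) (simp add: inflow[symmetric] sum_distrib_right)
    moreover have "?e t = (\<Sum>s\<in>UNIV. \<Sum>q\<in>UNIV. J t s q * \<phi> s)"
      by (simp add: outflow[symmetric] sum_distrib_right)
    ultimately have "?e (Suc t) - ?e t = (\<Sum>s\<in>UNIV. \<Sum>q\<in>UNIV. J t s q * (\<phi> q - \<phi> s))"
      by (simp add: sum_subtractf right_diff_distrib)
    also have "\<dots> = ?d t"
    proof (rule sum.mono_neutral_right)
      have "J t s q * (\<phi> q - \<phi> s) = 0" if "s \<notin> T" for s q
        using harm[OF that, of t q] J_nonneg[of t s q] by (cases "J t s q = 0") auto
      then show "\<forall>s\<in>UNIV - T. (\<Sum>q\<in>UNIV. J t s q * (\<phi> q - \<phi> s)) = 0"
        by (intro ballI sum.neutral) blast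
    qed auto
    finally show ?thesis .
  qed
  have "?d sums (\<Sum>s\<in>T. \<Sum>q\<in>UNIV. x s * pmf (Q s) q * (\<phi> q - \<phi> s))"
    by (intro sums_sum sums_mult2 moves)
  moreover have "(\<Sum>q\<in>UNIV. x s * pmf (Q s) q * (\<phi> q - \<phi> s)) = x s * (avg Q \<phi> s - \<phi> s)" for s
    by (simp add: avg_def right_diff_distrib sum_subtractf sum_distrib_left[symmetric]
        sum_distrib_right[symmetric] mult.assoc sum_pmf_UNIV)
  ultimately have "?d sums (\<Sum>s\<in>T. x s * (avg Q \<phi> s - \<phi> s))" by simp
  then have "(\<lambda>n. \<phi> s0 + (\<Sum>t<n. ?d t)) \<longlonglongrightarrow> \<phi> s0 + (\<Sum>s\<in>T. x s * (avg Q \<phi> s - \<phi> s))"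
    unfolding sums_def by (intro tendsto_intros)
  moreover have "?e n = \<phi> s0 + (\<Sum>t<n. ?d t)" for n
    unfolding diff[symmetric] sum_lessThan_telescope[of ?e n]
    by (simp add: start if_distrib[where f="\<lambda>x. x * _"] cong: if_cong)
  ultimately show ?thesis by simp
qed

text \<open>Test with \<open>G\<close>, the expected cost of \<open>k\<close> steps of
  \<open>Q\<close>. It vanishes off T and the flow leaves T, so the limit is 0 and
  \<open>G s0\<close> equals the sum of x (G - Q G). This difference telescopes to c minus the
  expected cost at time \<open>k\<close>, hence is at most c.\<close>

lemma occupation_bound:
  assumes closed: "\<And>s q. s \<notin> T \<Longrightarrow> pmf (Q s) q > 0 \<Longrightarrow> q \<notin> T"
    and J_closed: "\<And>t s q. s \<notin> T \<Longrightarrow> J t s q > 0 \<Longrightarrow> q \<notin> T"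
    and c: "\<And>s. 0 \<le> c s" "\<And>s. s \<notin> T \<Longrightarrow> c s = 0"
  shows "(\<Sum>t<k. (avg Q ^^ t) c s0) \<le> (\<Sum>s\<in>T. x s * c s)"
proof -
  define G where "G s = (\<Sum>t<k. (avg Q ^^ t) c s)" for s
  have off: "(avg Q ^^ t) c s = 0" if "s \<notin> T" for s t
    by (rule avg_funpow_closed[where B="- T"]) (use that in \<open>auto dest: closed simp: c\<close>)
  have nonneg: "0 \<le> (avg Q ^^ t) c s" for s t
  proof (induction t arbitrary: s)
    case (Suc n)
    then show ?case by (auto simp: avg_def intro!: sum_nonneg mult_nonneg_nonneg)
  qed (simp add: c)
  have G_off: "G s = 0" if "s \<notin> T" for s using off[OF that] by (simp add: G_def)
  have "(\<lambda>n. \<Sum>s\<in>UNIV. p n s * G s) \<longlonglongrightarrow> G s0 + (\<Sum>s\<in>T. x s * (avg Q G s - G s))"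
    by (rule potential_limit) (auto dest: J_closed simp: G_off)
  moreover have "(\<lambda>n. \<Sum>s\<in>UNIV. p n s * G s) \<longlonglongrightarrow> 0"
  proof -
    have "(\<lambda>n. p n s * G s) \<longlonglongrightarrow> 0" for s
      using p_tendsto_0[of s] G_off[of s] by (cases "s \<in> T") (auto intro: tendsto_mult_left_zero)
    then have "(\<lambda>n. \<Sum>s\<in>UNIV. p n s * G s) \<longlonglongrightarrow> (\<Sum>s\<in>(UNIV :: 's set). 0)"
      by (intro tendsto_sum)
    then show ?thesis by simp
  qed
  ultimately have eq: "G s0 + (\<Sum>s\<in>T. x s * (avg Q G s - G s)) = 0"
    by (rule LIMSEQ_unique)
  have "avg Q G s - G s = (avg Q ^^ k) c s - c s" for s
  proof -
    have "avg Q G s = (\<Sum>t<k. (avg Q ^^ Suc t) c s)" unfolding G_def avg_sum by simp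
    then have "avg Q G s - G s = (\<Sum>t<k. (avg Q ^^ Suc t) c s - (avg Q ^^ t) c s)"
      by (simp add: G_def sum_subtractf)
    also have "\<dots> = (avg Q ^^ k) c s - (avg Q ^^ 0) c s" by (rule sum_lessThan_telescope[of "\<lambda>t. (avg Q ^^ t) c s"])
    finally show ?thesis by simp
  qed
  then have "- (x s * c s) \<le> x s * (avg Q G s - G s)" if "s \<in> T" for s
    using mult_nonneg_nonneg[OF x_nonneg[OF that] nonneg[of k s]] by (simp add: right_diff_distrib)
  then have "(\<Sum>s\<in>T. - (x s * c s)) \<le> (\<Sum>s\<in>T. x s * (avg Q G s - G s))"
    by (intro sum_mono)
  then show ?thesis using eq by (simp add: sum_negf G_def)
qed

end

subsection \<open>Likelihood ratios of stationary policies\<close>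

lemma nn_integral_pmf_finite:
  fixes f :: "'b::finite \<Rightarrow> real"
  assumes "\<And>x. 0 \<le> f x"
  shows "(\<integral>\<^sup>+x. ennreal (f x) \<partial>measure_pmf p) = ennreal (\<Sum>x\<in>UNIV. pmf p x * f x)"
proof -
  have "(\<integral>\<^sup>+x. ennreal (f x) \<partial>measure_pmf p) = ennreal (\<integral>x. f x \<partial>measure_pmf p)"
    using assms by (intro nn_integral_eq_integral integrable_measure_pmf_finite) auto
  also have "(\<integral>x. f x \<partial>measure_pmf p) = (\<Sum>x\<in>UNIV. pmf p x * f x)"
    by (subst integral_measure_pmf_real[of UNIV]) (auto simp: mult.commute)
  finally show ?thesis .
qed

lemma length_prefix: "xs \<in> set_pmf (prefix_pmf M \<pi> n) \<Longrightarrow> length xs = Suc n"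
  by (auto simp: prefix_pmf_def dest: length_hist)

lemma prod_snoc_nth:
  fixes g :: "'b \<Rightarrow> 'b \<Rightarrow> real"
  assumes "length xs = Suc n"
  shows "(\<Prod>t<Suc n. g ((xs @ [q]) ! t) ((xs @ [q]) ! Suc t))
    = (\<Prod>t<n. g (xs ! t) (xs ! Suc t)) * g (last xs) q"
proof -
  have "(\<Prod>t<n. g ((xs @ [q]) ! t) ((xs @ [q]) ! Suc t)) = (\<Prod>t<n. g (xs ! t) (xs ! Suc t))"
    using assms by (intro prod.cong) (auto simp: nth_append)
  moreover have "xs ! n = last xs" using assms by (subst last_conv_nth) auto
  ultimately show ?thesis using assms by (simp add: nth_append)
qed

lemma nn_integral_prefix_Suc:
  fixes M :: "('s::finite, 'a::finite) mdp"
  assumes "\<And>h. \<pi> h = \<mu> (last_state h)"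
  shows "(\<integral>\<^sup>+xs. F xs \<partial>prefix_pmf M \<pi> (Suc n))
    = (\<integral>\<^sup>+xs. \<integral>\<^sup>+q. F (xs @ [q]) \<partial>bind_pmf (\<mu> (last xs)) (trans M (last xs)) \<partial>prefix_pmf M \<pi> n)"
  by (simp only: prefix_pmf_stationary(2)[where \<pi>=\<pi> and \<mu>=\<mu>, OF assms] nn_integral_bind_pmf
      nn_integral_map_pmf)

lemma measurable_prefix:
  fixes F :: "'s::finite list \<Rightarrow> 'b::topological_space"
  shows "(\<lambda>p. F (map p [0..<n])) \<in> borel_measurable (path_measure M \<pi>)"
  unfolding measurable_cong_sets[OF sets_path_measure refl]
  by (rule measurable_compose[OF measurable_map_upt]) simp

text \<open>The product of the weights \<open>c\<close> times \<open>u\<close> at the current state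
  is a supermartingale. This turns a Lyapunov function into an exponential moment bound for visit
  counts.\<close>

lemma nn_integral_supermartingale:
  fixes M :: "('s::finite, 'a::finite) mdp"
  assumes st: "\<And>h. \<pi> h = \<mu> (last_state h)" and nonneg: "\<And>s. 0 \<le> c s" "\<And>s. 0 \<le> u s"
    and super: "\<And>s. c s * avg (\<lambda>s. bind_pmf (\<mu> s) (trans M s)) u s \<le> u s"
  shows "(\<integral>\<^sup>+p. ennreal ((\<Prod>t<n. c (p t)) * u (p n)) \<partial>path_measure M \<pi>) \<le> ennreal (u (init M))"
proof -
  let ?F = "\<lambda>n xs. ennreal ((\<Prod>t<n. c (xs ! t)) * u (xs ! n))"
  have "(\<integral>\<^sup>+xs. ?F n xs \<partial>prefix_pmf M \<pi> n) \<le> ennreal (u (init M))"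
  proof (induction n)
    case 0
    show ?case by (simp add: prefix_pmf_def)
  next
    case (Suc n)
    have "(\<integral>\<^sup>+q. ?F (Suc n) (xs @ [q]) \<partial>bind_pmf (\<mu> (last xs)) (trans M (last xs))) \<le> ?F n xs"
      if "xs \<in> set_pmf (prefix_pmf M \<pi> n)" for xs
    proof -
      have len: "length xs = Suc n" using that by (rule length_prefix)
      let ?k = "\<Prod>t<n. c (xs ! t)"
      have last: "xs ! n = last xs" using len by (subst last_conv_nth) auto
      have "(\<integral>\<^sup>+q. ?F (Suc n) (xs @ [q]) \<partial>bind_pmf (\<mu> (last xs)) (trans M (last xs)))
          = (\<integral>\<^sup>+q. ennreal (?k * c (last xs) * u q) \<partial>bind_pmf (\<mu> (last xs)) (trans M (last xs)))"
        unfolding prod_snoc_nth[OF len, of "\<lambda>s q. c s"] using len by (simp add: nth_append)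
      also have "\<dots> = ennreal (?k * (c (last xs) * avg (\<lambda>s. bind_pmf (\<mu> s) (trans M s)) u (last xs)))"
        using nonneg
        by (subst nn_integral_pmf_finite) (auto simp: prod_nonneg avg_def sum_distrib_left mult_ac simp del: pmf_bind)
      also have "\<dots> \<le> ?F n xs"
        unfolding last by (intro ennreal_leI mult_left_mono super prod_nonneg) (auto simp: nonneg)
      finally show ?thesis .
    qed
    then have "(\<integral>\<^sup>+xs. ?F (Suc n) xs \<partial>prefix_pmf M \<pi> (Suc n)) \<le> (\<integral>\<^sup>+xs. ?F n xs \<partial>prefix_pmf M \<pi> n)"
      unfolding nn_integral_prefix_Suc[where M=M and \<pi>=\<pi> and \<mu>=\<mu>, OF st]
      by (intro nn_integral_mono_AE) (simp add: AE_measure_pmf_iff)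
    then show ?case using Suc by (rule order_trans)
  qed
  then show ?thesis
    unfolding nn_integral_path_prefix[symmetric] by (simp add: nth_append del: upt_Suc)
qed

text \<open>Used to sharpen Fatou's inequality on a set and on its complement to an equality once no
  mass is lost in total.\<close>

lemma ennreal_eq_of_sum_le:
  fixes a b c d :: ennreal
  assumes "a \<le> c" "b \<le> d" "c + d \<le> a + b" "c + d < \<top>"
  shows "a = c"
proof (rule antisym[OF assms(1)])
  have "c + b \<le> a + b" using assms add_left_mono[of b d c] by (meson order_trans)
  moreover have "b < \<top>" using assms by (auto simp: less_top[symmetric] top_unique)
  ultimately show "c \<le> a" by (cases "b = \<top>") (auto simp: ennreal_add_left_cancel_le add.commute)
qed

text \<open>Two chains with one-step likelihood ratio \<open>r\<close>: \<open>ratio\<close> makes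
  \<open>Q s\<close> absolutely continuous with respect to \<open>P s\<close>, and by
  \<open>r_off\<close> the kernels agree off T.\<close>

locale likelihood =
  fixes M :: "('s::finite, 'a::finite) mdp" and \<pi>P \<pi>Q :: "('s, 'a) policy"
    and \<mu>P \<mu>Q :: "'s \<Rightarrow> 'a pmf" and P Q :: "'s \<Rightarrow> 's pmf"
    and T :: "'s set" and r :: "'s \<Rightarrow> 's \<Rightarrow> real"
  assumes stP: "\<And>h. \<pi>P h = \<mu>P (last_state h)" and stQ: "\<And>h. \<pi>Q h = \<mu>Q (last_state h)"
    and P_def: "\<And>s. P s = bind_pmf (\<mu>P s) (trans M s)"
    and Q_def: "\<And>s. Q s = bind_pmf (\<mu>Q s) (trans M s)"
    and r_nonneg: "\<And>s q. 0 \<le> r s q"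
    and ratio: "\<And>s q. pmf (Q s) q = r s q * pmf (P s) q"
    and r_off: "\<And>s q. s \<notin> T \<Longrightarrow> r s q = 1"
    and closed: "\<And>s q. s \<notin> T \<Longrightarrow> pmf (P s) q > 0 \<Longrightarrow> q \<notin> T"
begin

abbreviation \<P> where "\<P> \<equiv> path_measure M \<pi>P"
abbreviation \<Q> where "\<Q> \<equiv> path_measure M \<pi>Q"

definition L :: "nat \<Rightarrow> (nat \<Rightarrow> 's) \<Rightarrow> real" where
  "L n p = (\<Prod>t<n. r (p t) (p (Suc t)))"

text \<open>The lower limit exists on every path and is measurable; on paths that leave the set T
  for good, \<open>L\<close> becomes constant and this is its final value.\<close>

definition Linf :: "(nat \<Rightarrow> 's) \<Rightarrow> ennreal" where
  "Linf p = liminf (\<lambda>n. ennreal (L n p))"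

lemma L_nonneg: "0 \<le> L n p"
  by (simp add: L_def prod_nonneg r_nonneg)

lemma L_prefix: "L n p = (\<Prod>t<n. r (map p [0..<Suc n] ! t) (map p [0..<Suc n] ! Suc t))"
proof -
  have "map p [0..<Suc n] ! t = p t" if "t \<le> n" for t
    using that by (simp del: upt_Suc)
  then show ?thesis unfolding L_def by (intro prod.cong refl) (simp del: upt_Suc)
qed

lemma measurable_L [measurable]: "L n \<in> borel_measurable (path_measure M \<pi>)"
proof -
  have "L n = (\<lambda>p. (\<lambda>xs. \<Prod>t<n. r (xs ! t) (xs ! Suc t)) (map p [0..<Suc n]))"
    by (rule ext) (simp only: L_prefix)
  then show ?thesis
    using measurable_prefix[of "\<lambda>xs. \<Prod>t<n. r (xs ! t) (xs ! Suc t)" "Suc n" M \<pi>] by metis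
qed

lemma measurable_Linf [measurable]: "Linf \<in> borel_measurable (path_measure M \<pi>)"
  unfolding Linf_def[abs_def] by measurable

lemma nn_integral_Q: "(\<integral>\<^sup>+q. f q \<partial>Q s) = (\<integral>\<^sup>+q. ennreal (r s q) * f q \<partial>P s)"
  by (simp add: nn_integral_measure_pmf ratio ennreal_mult r_nonneg mult_ac)

text \<open>Along the Markov recursion, the last ratio is absorbed by replacing the kernel
  \<open>Q\<close> by \<open>P\<close>, the earlier ones by the hypothesis for the integrated
  function.\<close>

lemma nn_integral_prefix_change:
  "(\<integral>\<^sup>+xs. F xs \<partial>prefix_pmf M \<pi>Q n)
    = (\<integral>\<^sup>+xs. ennreal (\<Prod>t<n. r (xs ! t) (xs ! Suc t)) * F xs \<partial>prefix_pmf M \<pi>P n)"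
proof (induction n arbitrary: F)
  case 0
  show ?case by (simp add: prefix_pmf_def)
next
  case (Suc n)
  let ?l = "\<lambda>n xs. \<Prod>t<n. r (xs ! t) (xs ! Suc t)"
  have "(\<integral>\<^sup>+xs. F xs \<partial>prefix_pmf M \<pi>Q (Suc n))
      = (\<integral>\<^sup>+xs. ennreal (?l n xs) * (\<integral>\<^sup>+q. F (xs @ [q]) \<partial>Q (last xs)) \<partial>prefix_pmf M \<pi>P n)"
    by (subst nn_integral_prefix_Suc[where M=M and \<pi>=\<pi>Q and \<mu>=\<mu>Q, OF stQ]) (simp only: Q_def Suc)
  also have "\<dots> = (\<integral>\<^sup>+xs. \<integral>\<^sup>+q. ennreal (?l (Suc n) (xs @ [q])) * F (xs @ [q]) \<partial>P (last xs) \<partial>prefix_pmf M \<pi>P n)"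
  proof (rule nn_integral_cong_AE, unfold AE_measure_pmf_iff, intro ballI)
    fix xs assume "xs \<in> set_pmf (prefix_pmf M \<pi>P n)"
    then have len: "length xs = Suc n" by (rule length_prefix)
    show "ennreal (?l n xs) * (\<integral>\<^sup>+q. F (xs @ [q]) \<partial>Q (last xs))
        = (\<integral>\<^sup>+q. ennreal (?l (Suc n) (xs @ [q])) * F (xs @ [q]) \<partial>P (last xs))"
      unfolding nn_integral_Q prod_snoc_nth[OF len]
      by (subst nn_integral_cmult[symmetric]) (auto simp: ennreal_mult prod_nonneg r_nonneg mult.assoc)
  qed
  also have "\<dots> = (\<integral>\<^sup>+xs. ennreal (?l (Suc n) xs) * F xs \<partial>prefix_pmf M \<pi>P (Suc n))"
    by (subst nn_integral_prefix_Suc[where M=M and \<pi>=\<pi>P and \<mu>=\<mu>P, OF stP]) (simp only: P_def)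
  finally show ?case .
qed

lemma nn_integral_change:
  "(\<integral>\<^sup>+p. F (map p [0..<Suc n]) \<partial>\<Q>) = (\<integral>\<^sup>+p. ennreal (L n p) * F (map p [0..<Suc n]) \<partial>\<P>)"
  unfolding nn_integral_path_prefix nn_integral_prefix_change L_prefix
  by (rule nn_integral_path_prefix[symmetric])

lemma nn_integral_L: "(\<integral>\<^sup>+p. ennreal (L n p) \<partial>\<P>) = 1"
proof -
  interpret Q: prob_space \<Q> by (rule prob_space_path_measure)
  show ?thesis using nn_integral_change[of "\<lambda>_. 1" n] Q.emeasure_space_1 by simp
qed

lemma closed_Q: "s \<notin> T \<Longrightarrow> pmf (Q s) q > 0 \<Longrightarrow> q \<notin> T"
  using closed[of s q] by (simp add: ratio r_off)

lemma move_P: "pmf (move_pmf M \<pi>P t) (s, q) = pmf (state_pmf M \<pi>P t) s * pmf (P s) q"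
  unfolding P_def by (rule pmf_move_stationary[where M=M and \<pi>=\<pi>P and \<mu>=\<mu>P, OF stP])

lemma move_Q: "pmf (move_pmf M \<pi>Q t) (s, q) = pmf (state_pmf M \<pi>Q t) s * pmf (Q s) q"
  unfolding Q_def by (rule pmf_move_stationary[where M=M and \<pi>=\<pi>Q and \<mu>=\<mu>Q, OF stQ])

lemma AE_closed_P: "AE p in \<P>. \<forall>t. p t \<notin> T \<longrightarrow> p (Suc t) \<notin> T"
  unfolding AE_all_countable
proof
  fix t
  show "AE p in \<P>. p t \<notin> T \<longrightarrow> p (Suc t) \<notin> T"
    by (subst AE_move) (auto simp: move_P zero_less_mult_iff dest: closed)
qed

lemma AE_closed_Q: "AE p in \<Q>. \<forall>t. p t \<notin> T \<longrightarrow> p (Suc t) \<notin> T"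
  unfolding AE_all_countable
proof
  fix t
  show "AE p in \<Q>. p t \<notin> T \<longrightarrow> p (Suc t) \<notin> T"
    by (subst AE_move) (auto simp: move_Q zero_less_mult_iff dest: closed_Q)
qed

lemma stays_out:
  assumes "\<forall>t. p t \<notin> T \<longrightarrow> p (Suc t) \<notin> T" "p m \<notin> T" "m \<le> n"
  shows "p n \<notin> T"
  using assms(3) by (induction rule: dec_induct) (use assms in auto)

lemma L_eventually_const:
  assumes "\<forall>t. p t \<notin> T \<longrightarrow> p (Suc t) \<notin> T" "p m \<notin> T" "m \<le> n"
  shows "L n p = L m p"
  using assms(3)
proof (induction rule: dec_induct)
  case (step n)
  then show ?case using r_off[OF stays_out[OF assms(1,2) step(1)]] by (simp add: L_def)
qed simp

lemma Linf_eq: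
  assumes "\<forall>t. p t \<notin> T \<longrightarrow> p (Suc t) \<notin> T" "p m \<notin> T"
  shows "Linf p = ennreal (L m p)"
proof -
  have "(\<lambda>n. ennreal (L n p)) \<longlonglongrightarrow> ennreal (L m p)"
    by (rule tendsto_eventually, unfold eventually_sequentially)
      (intro exI[of _ m] allI impI arg_cong[where f=ennreal] L_eventually_const[OF assms])
  then show ?thesis unfolding Linf_def by (intro lim_imp_Liminf) auto
qed

end

locale transient_likelihood = likelihood +
  assumes transient: "\<And>s. s \<in> T \<Longrightarrow> summable (\<lambda>t. pmf (state_pmf M \<pi>Q t) s)"
begin

section \<open>Exit from T and the density of the path laws\<close>

lemma exit_tendsto: "(\<lambda>m. \<Sum>s\<in>- T. pmf (state_pmf M \<pi>Q m) s) \<longlonglongrightarrow> 1"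
proof -
  have "(\<lambda>m. 1 - (\<Sum>s\<in>T. pmf (state_pmf M \<pi>Q m) s)) \<longlonglongrightarrow> 1 - (\<Sum>s\<in>T. 0)"
    by (intro tendsto_intros summable_LIMSEQ_zero transient)
  moreover have "1 - (\<Sum>s\<in>T. pmf p s) = (\<Sum>s\<in>- T. pmf p s)" for p :: "'a pmf"
    using sum.union_disjoint[of T "- T" "pmf p"] sum_pmf_UNIV[of p] by simp
  ultimately show ?thesis by simp
qed

lemma AE_exit: "AE p in \<Q>. \<exists>m. p m \<notin> T"
proof -
  interpret prob_space \<Q> by (rule prob_space_path_measure)
  have sets: "{p. \<exists>m. p m \<notin> T} \<in> events"
  proof -
    have "{p. \<exists>m. p m \<notin> T} = (\<Union>m. {p. p m \<in> - T})" by auto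
    also have "\<dots> \<in> events" using path_measurable[of "\<lambda>s. s \<in> - T" _ M \<pi>Q] by (intro sets.countable_UN) auto
    finally show ?thesis .
  qed
  have "1 \<le> prob {p. \<exists>m. p m \<notin> T}"
  proof (rule LIMSEQ_le_const2[OF exit_tendsto])
    have "prob {p. p m \<in> - T} \<le> prob {p. \<exists>m. p m \<notin> T}" for m
      by (rule finite_measure_mono[OF _ sets]) auto
    then show "\<exists>N. \<forall>n\<ge>N. (\<Sum>s\<in>- T. pmf (state_pmf M \<pi>Q n) s) \<le> prob {p. \<exists>m. p m \<notin> T}"
      unfolding measure_path_state by blast
  qed
  then have "prob {p. \<exists>m. p m \<notin> T} = 1" using prob_le_1 antisym by blast
  then show ?thesis using AE_in_set_eq_1[OF sets] by simp
qed

text \<open>On paths outside T at time \<open>m\<close> the limit equals \<open>L m\<close>, whose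
  integral there is the \<open>\<Q>\<close>-probability of being outside T. That probability tends
  to 1, so no mass escapes.\<close>

lemma Linf_total: "1 \<le> (\<integral>\<^sup>+p. Linf p \<partial>\<P>)"
proof -
  interpret Q: prob_space \<Q> by (rule prob_space_path_measure)
  have "ennreal (\<Sum>s\<in>- T. pmf (state_pmf M \<pi>Q m) s) \<le> (\<integral>\<^sup>+p. Linf p \<partial>\<P>)" for m
  proof -
    have "ennreal (\<Sum>s\<in>- T. pmf (state_pmf M \<pi>Q m) s) = emeasure \<Q> {p. p m \<in> - T}"
      by (simp only: measure_path_state[symmetric] Q.emeasure_eq_measure)
    also have "\<dots> = (\<integral>\<^sup>+p. indicator {p. p m \<in> - T} p \<partial>\<Q>)"
      using path_measurable[of "\<lambda>s. s \<in> - T" m M \<pi>Q] by simp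
    also have "\<dots> = (\<integral>\<^sup>+p. indicator {xs. xs ! m \<in> - T} (map p [0..<Suc m]) \<partial>\<Q>)"
      by (intro nn_integral_cong) (auto simp: indicator_def nth_append)
    also have "\<dots> = (\<integral>\<^sup>+p. ennreal (L m p) * indicator {xs. xs ! m \<in> - T} (map p [0..<Suc m]) \<partial>\<P>)"
      by (rule nn_integral_change)
    also have "\<dots> \<le> (\<integral>\<^sup>+p. Linf p \<partial>\<P>)"
      by (rule nn_integral_mono_AE, use AE_closed_P in eventually_elim)
        (auto simp: Linf_eq indicator_def nth_append)
    finally show ?thesis .
  qed
  moreover have "(\<lambda>m. ennreal (\<Sum>s\<in>- T. pmf (state_pmf M \<pi>Q m) s)) \<longlonglongrightarrow> ennreal 1"
    by (intro tendsto_ennrealI exit_tendsto)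
  ultimately show ?thesis by (intro LIMSEQ_le_const2[of _ 1]) auto
qed

text \<open>Fatou's lemma: from time \<open>k\<close> on, \<open>L n\<close> is already the exact
  density for events of the first \<open>k + 1\<close> states.\<close>

lemma Linf_cylinder_le:
  "(\<integral>\<^sup>+p. Linf p * indicator C (map p [0..<Suc k]) \<partial>\<P>) \<le> (\<integral>\<^sup>+p. indicator C (map p [0..<Suc k]) \<partial>\<Q>)"
proof -
  let ?I = "\<lambda>p. indicator C (map p [0..<Suc k]) :: ennreal"
  have m: "?I \<in> borel_measurable \<P>" by (rule measurable_prefix)
  have "(\<integral>\<^sup>+p. Linf p * ?I p \<partial>\<P>) \<le> (\<integral>\<^sup>+p. liminf (\<lambda>n. ennreal (L n p) * ?I p) \<partial>\<P>)"
    by (intro nn_integral_mono) (simp add: Linf_def indicator_def)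
  also have "\<dots> \<le> liminf (\<lambda>n. \<integral>\<^sup>+p. ennreal (L n p) * ?I p \<partial>\<P>)"
    using m by (intro nn_integral_liminf) auto
  also have "\<dots> = (\<integral>\<^sup>+p. ?I p \<partial>\<Q>)"
  proof (rule lim_imp_Liminf)
    have "(\<integral>\<^sup>+p. ennreal (L n p) * ?I p \<partial>\<P>) = (\<integral>\<^sup>+p. ?I p \<partial>\<Q>)" if "k \<le> n" for n
    proof -
      have "take (Suc k) (map p [0..<Suc n]) = map p [0..<Suc k]" for p :: "nat \<Rightarrow> 'a"
        using that by (simp only: take_map take_upt) (simp add: take_upt del: upt_Suc)
      then show ?thesis
        using nn_integral_change[of "\<lambda>xs. indicator C (take (Suc k) xs)" n] by simp
    qed
    then show "(\<lambda>n. \<integral>\<^sup>+p. ennreal (L n p) * ?I p \<partial>\<P>) \<longlonglongrightarrow> (\<integral>\<^sup>+p. ?I p \<partial>\<Q>)"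
      by (intro tendsto_eventually) (auto simp: eventually_sequentially)
  qed simp
  finally show ?thesis .
qed

lemma Linf_cylinder:
  "(\<integral>\<^sup>+p. Linf p * indicator C (map p [0..<Suc k]) \<partial>\<P>) = (\<integral>\<^sup>+p. indicator C (map p [0..<Suc k]) \<partial>\<Q>)"
proof (rule ennreal_eq_of_sum_le[OF Linf_cylinder_le Linf_cylinder_le[of "- C" k]])
  interpret Q: prob_space \<Q> by (rule prob_space_path_measure)
  let ?I = "\<lambda>C p. indicator C (map p [0..<Suc k]) :: ennreal"
  have m: "?I C \<in> borel_measurable (path_measure M \<pi>)" for C \<pi> by (rule measurable_prefix)
  have "(\<integral>\<^sup>+p. ?I C p \<partial>\<Q>) + (\<integral>\<^sup>+p. ?I (- C) p \<partial>\<Q>) = (\<integral>\<^sup>+p. ?I C p + ?I (- C) p \<partial>\<Q>)"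
    using m by (subst nn_integral_add) auto
  also have "\<dots> = (\<integral>\<^sup>+p. 1 \<partial>\<Q>)" by (intro nn_integral_cong) (auto simp: indicator_def)
  finally have 1: "(\<integral>\<^sup>+p. ?I C p \<partial>\<Q>) + (\<integral>\<^sup>+p. ?I (- C) p \<partial>\<Q>) = 1"
    using Q.emeasure_space_1 by simp
  have "(\<integral>\<^sup>+p. Linf p * ?I C p \<partial>\<P>) + (\<integral>\<^sup>+p. Linf p * ?I (- C) p \<partial>\<P>) = (\<integral>\<^sup>+p. Linf p * ?I C p + Linf p * ?I (- C) p \<partial>\<P>)"
    using m by (subst nn_integral_add) auto
  also have "\<dots> = (\<integral>\<^sup>+p. Linf p \<partial>\<P>)" by (intro nn_integral_cong) (auto simp: indicator_def)
  finally show "(\<integral>\<^sup>+p. ?I C p \<partial>\<Q>) + (\<integral>\<^sup>+p. ?I (- C) p \<partial>\<Q>)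
      \<le> (\<integral>\<^sup>+p. Linf p * ?I C p \<partial>\<P>) + (\<integral>\<^sup>+p. Linf p * ?I (- C) p \<partial>\<P>)"
    unfolding 1 using Linf_total by simp
  show "(\<integral>\<^sup>+p. ?I C p \<partial>\<Q>) + (\<integral>\<^sup>+p. ?I (- C) p \<partial>\<Q>) < \<top>" unfolding 1 by simp
qed

lemma path_measure_density: "\<Q> = density \<P> Linf"
proof (rule measure_eqI_PiM_infinite)
  interpret Q: prob_space \<Q> by (rule prob_space_path_measure)
  show "finite_measure \<Q>" by unfold_locales
  fix A :: "nat \<Rightarrow> 'a set" and J :: "nat set"
  assume J: "finite J"
  \<comment> \<open>All coordinates in \<open>J\<close> are read off the first \<open>k + 1\<close>
    states; \<open>insert 0\<close> provides for an empty \<open>J\<close>.\<close>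
  define k where "k = Max (insert 0 J)"
  define C where "C = {xs. \<forall>j\<in>J. xs ! j \<in> A j}"
  let ?X = "prod_emb UNIV (\<lambda>_. count_space UNIV) J (Pi\<^sub>E J A)"
  have k: "j \<le> k" if "j \<in> J" for j using J that by (simp add: k_def)
  have nth: "map p [0..<Suc k] ! j = p j" if "j \<in> J" for j and p :: "nat \<Rightarrow> 'a"
    using k[OF that] by (simp add: nth_append)
  have ind: "indicator ?X p = (indicator C (map p [0..<Suc k]) :: ennreal)" for p
    by (auto simp: indicator_def C_def prod_emb_def space_PiM nth simp del: upt_Suc)
  have X: "?X \<in> sets (path_measure M \<pi>)" for \<pi>
    using J by (simp add: sets_PiM_I)
  have "emeasure \<Q> ?X = (\<integral>\<^sup>+p. indicator ?X p \<partial>\<Q>)" using X by simp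
  also have "\<dots> = (\<integral>\<^sup>+p. Linf p * indicator ?X p \<partial>\<P>)" unfolding ind Linf_cylinder ..
  also have "\<dots> = emeasure (density \<P> Linf) ?X" using X by (simp add: emeasure_density)
  finally show "emeasure \<Q> ?X = emeasure (density \<P> Linf) ?X" .
qed simp_all

text \<open>The logarithm of the density is the series of the one-step log ratios. Almost surely it
  has finitely many nonzero terms, and finite expected visits to T make it absolutely integrable, so
  it may be integrated term by term; \<open>D\<close> is the one-step divergence.\<close>

lemma KL_path_measure:
  defines "D \<equiv> \<lambda>s. avg Q (\<lambda>q. ln (r s q)) s"
  shows "\<exists>y. (\<lambda>t. \<Sum>s\<in>T. pmf (state_pmf M \<pi>Q t) s * D s) sums y \<and> KL \<Q> \<P> = ereal y"
proof -
  define ll where "ll t p = ln (r (p t) (p (Suc t)))" for t p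
  have D_off: "D s = 0" if "s \<notin> T" for s unfolding D_def by (rule avg_const) (simp add: r_off[OF that])
  have int: "integrable \<Q> (ll t)" for t
    unfolding ll_def using expectation_move(2)[where \<phi>="\<lambda>s q. ln (r s q)"] .
  have exp: "(\<integral>p. ll t p \<partial>\<Q>) = (\<Sum>s\<in>T. pmf (state_pmf M \<pi>Q t) s * D s)" for t
  proof -
    have "(\<integral>p. ll t p \<partial>\<Q>) = (\<Sum>s\<in>UNIV. pmf (state_pmf M \<pi>Q t) s * D s)"
      unfolding ll_def expectation_move(1)[where \<phi>="\<lambda>s q. ln (r s q)"] move_Q D_def avg_def
      by (simp add: sum_distrib_left mult.assoc)
    also have "\<dots> = (\<Sum>s\<in>T. pmf (state_pmf M \<pi>Q t) s * D s)"
      by (rule sum.mono_neutral_right) (auto simp: D_off)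
    finally show ?thesis .
  qed
  define c where "c s = avg Q (\<lambda>q. \<bar>ln (r s q)\<bar>) s" for s
  have c_off: "c s = 0" if "s \<notin> T" for s unfolding c_def by (rule avg_const) (simp add: r_off[OF that])
  have norm: "(\<integral>p. norm (ll t p) \<partial>\<Q>) = (\<Sum>s\<in>T. pmf (state_pmf M \<pi>Q t) s * c s)" for t
  proof -
    have "(\<integral>p. norm (ll t p) \<partial>\<Q>) = (\<Sum>s\<in>UNIV. pmf (state_pmf M \<pi>Q t) s * c s)"
      unfolding ll_def real_norm_def expectation_move(1)[where \<phi>="\<lambda>s q. \<bar>ln (r s q)\<bar>"] move_Q c_def avg_def
      by (simp add: sum_distrib_left mult.assoc)
    also have "\<dots> = (\<Sum>s\<in>T. pmf (state_pmf M \<pi>Q t) s * c s)"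
      by (rule sum.mono_neutral_right) (auto simp: c_off)
    finally show ?thesis .
  qed
  have sum_norm: "summable (\<lambda>t. \<integral>p. norm (ll t p) \<partial>\<Q>)"
    unfolding norm by (intro summable_sum summable_mult2 transient)
  have zero: "ll t p = 0" if "\<forall>t. p t \<notin> T \<longrightarrow> p (Suc t) \<notin> T" "p m \<notin> T" "m \<le> t" for p m t
    using r_off[OF stays_out[OF that]] by (simp add: ll_def)
  have AE_sum: "AE p in \<Q>. summable (\<lambda>t. norm (ll t p))"
    using AE_exit AE_closed_Q
  proof eventually_elim
    case (elim p)
    then obtain m where "p m \<notin> T" by blast
    from zero[OF elim(2) this] show ?case
      by (intro summable_finite[of "{..<m}"]) auto
  qed
  \<comment> \<open>Positive ratios along the path let \<open>exp\<close> of the sum of logarithms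
    return the product \<open>L\<close>.\<close>
  have pos: "AE p in \<Q>. \<forall>t. 0 < r (p t) (p (Suc t))"
    unfolding AE_all_countable
  proof
    fix t show "AE p in \<Q>. 0 < r (p t) (p (Suc t))"
      by (subst AE_move) (auto simp: move_Q ratio zero_less_mult_iff)
  qed
  let ?l = "\<lambda>p. \<Sum>t. ll t p"
  have "KL \<Q> \<P> = ereal (\<integral>p. ?l p \<partial>\<Q>)"
  proof (rule KL_density_exp[OF prob_space_path_measure path_measure_density])
    show "integrable \<Q> ?l" by (rule integrable_suminf[OF int AE_sum sum_norm])
    show "AE p in \<Q>. Linf p = ennreal (exp (?l p))"
      using AE_exit AE_closed_Q pos
    proof eventually_elim
      case (elim p)
      then obtain m where m: "p m \<notin> T" by blast
      have "?l p = (\<Sum>t<m. ll t p)"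
        by (rule suminf_finite) (use zero[OF elim(2) m] in auto)
      then have "exp (?l p) = L m p"
        using elim(3) by (simp add: exp_sum ll_def L_def)
      then show ?case using Linf_eq[OF elim(2) m] by simp
    qed
  qed simp
  moreover have "(\<lambda>t. \<integral>p. ll t p \<partial>\<Q>) sums (\<integral>p. ?l p \<partial>\<Q>)"
    by (rule sums_integral[OF int AE_sum sum_norm])
  ultimately show ?thesis unfolding exp by blast
qed

end

subsection \<open>The averaged stationary policy\<close>

lemma pmf_eq_1_return: "pmf p x = 1 \<Longrightarrow> p = return_pmf x"
  by (rule pmf_eqI) (simp add: pmf_eq_1_D indicator_def)

lemma absorbing_bind:
  assumes "set_pmf \<alpha> \<subseteq> avail M s" "absorbing M s"
  shows "bind_pmf \<alpha> (trans M s) = return_pmf s"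
proof -
  have "bind_pmf \<alpha> (trans M s) = bind_pmf \<alpha> (\<lambda>_. return_pmf s)"
    using assms by (intro bind_pmf_cong refl pmf_eq_1_return) (auto simp: absorbing_def)
  then show ?thesis by simp
qed

lemma state_pmf_avg:
  fixes M :: "('s::finite, 'a::finite) mdp"
  assumes st: "\<And>h. \<pi> h = \<mu> (last_state h)" and K: "\<And>s. K s = bind_pmf (\<mu> s) (trans M s)"
  shows "(\<Sum>s\<in>UNIV. pmf (state_pmf M \<pi> n) s * \<phi> s) = (avg K ^^ n) \<phi> (init M)"
proof (induction n arbitrary: \<phi>)
  case 0
  show ?case by (simp add: state_pmf_0 indicator_def)
next
  case (Suc n)
  have "(\<Sum>s\<in>UNIV. pmf (state_pmf M \<pi> (Suc n)) s * \<phi> s) = (\<Sum>s\<in>UNIV. pmf (state_pmf M \<pi> n) s * avg K \<phi> s)"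
    unfolding expectation_step pmf_move_stationary[where M=M and \<pi>=\<pi> and \<mu>=\<mu>, OF st] K[symmetric]
    by (simp add: avg_def sum_distrib_left mult.assoc)
  also have "\<dots> = (avg K ^^ n) (avg K \<phi>) (init M)" by (rule Suc)
  also have "\<dots> = (avg K ^^ Suc n) \<phi> (init M)" by (simp only: funpow.simps comp_def funpow_swap1)
  finally show ?case .
qed

lemma measurable_path_state: "(\<lambda>p. c (p t) :: real) \<in> borel_measurable (path_measure M \<pi>)"
  using expectation_state(2)[of M \<pi> c t] by (rule borel_measurable_integrable)

locale finite_kl =
  fixes M :: "('s::finite, 'a::finite) mdp" and R :: "'s set" and \<pi>S \<pi>A :: "('s, 'a) policy"
    and \<mu>S :: "'s \<Rightarrow> 'a pmf"
  assumes absorb: "\<And>s. s \<in> R \<Longrightarrow> absorbing M s"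
    and pol_S: "\<pi>S \<in> policies M" and stS: "\<And>h. \<pi>S h = \<mu>S (last_state h)"
    and pol_A: "\<pi>A \<in> policies M"
    and ac: "absolutely_continuous (path_measure M \<pi>S) (path_measure M \<pi>A)"
    and int: "integrable (path_measure M \<pi>A) (entropy_density (exp 1) (path_measure M \<pi>S) (path_measure M \<pi>A))"
begin

abbreviation \<S> where "\<S> \<equiv> path_measure M \<pi>S"
abbreviation \<A> where "\<A> \<equiv> path_measure M \<pi>A"
abbreviation J where "J t s q \<equiv> pmf (move_pmf M \<pi>A t) (s, q)"
abbreviation p where "p t s \<equiv> pmf (state_pmf M \<pi>A t) s"
abbreviation kl where "kl \<equiv> KL_divergence (exp 1) \<S> \<A>"

section \<open>Finite divergence: expected visits to the transient set\<close>

definition P where "P s = bind_pmf (\<mu>S s) (trans M s)"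

lemma avail_S: "set_pmf (\<mu>S s) \<subseteq> avail M s"
proof -
  have "set_pmf (\<pi>S (s, [])) \<subseteq> avail M (last_state (s, [] :: ('a \<times> 's) list))"
    using pol_S unfolding policies_def mem_Collect_eq by (rule spec)
  then show ?thesis by (simp add: stS)
qed

sublocale K: absorbing_kernel P R
  by standard (simp add: P_def absorbing_bind avail_S absorb)

abbreviation T where "T \<equiv> K.unresolved"

text \<open>Moves impossible under the reference kernel form a null event of its path law, hence of
  that of \<open>\<pi>A\<close>.\<close>

lemma J_ac: assumes "J t s q > 0" shows "pmf (P s) q > 0"
proof -
  have "AE p in \<S>. pmf (P (p t)) (p (Suc t)) > 0"
    by (subst AE_move) (auto simp: pmf_move_stationary[where M=M and \<pi>=\<pi>S and \<mu>=\<mu>S, OF stS]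
      P_def zero_less_mult_iff simp del: pmf_bind)
  then have "AE p in \<A>. pmf (P (p t)) (p (Suc t)) > 0"
    by (rule absolutely_continuous_AE[rotated 2]) (use ac in auto)
  then show ?thesis using assms by (subst (asm) AE_move) blast
qed

lemma J_closed: "s \<notin> T \<Longrightarrow> J t s q > 0 \<Longrightarrow> q \<notin> T"
  by (rule K.resolved_closed[OF _ J_ac])

lemma variational:
  assumes "W \<in> borel_measurable \<S>" "\<And>x. 0 \<le> W x" "(\<integral>\<^sup>+x. ennreal (W x) \<partial>\<S>) \<le> 1"
    and "AE x in \<A>. 0 < W x" and "integrable \<A> (\<lambda>x. ln (W x))"
  shows "(\<integral>x. ln (W x) \<partial>\<A>) \<le> kl"
  by (rule gibbs_variational[OF prob_space_path_measure prob_space_path_measure _ ac int assms]) simp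

text \<open>Apply the variational bound to a weight \<open>W\<close> that gains a factor 1/\<kappa>
  at each visit to T, divided by the initial value of the Lyapunov function. The expectation of ln W
  is then - ln \<kappa> times the expected visits, up to a constant, and stays below
  \<open>kl\<close> for every horizon.\<close>

lemma visits_bounded: "\<exists>B. \<forall>n. (\<Sum>t<n. \<Sum>s\<in>T. p t s) \<le> B"
proof -
  interpret A: prob_space \<A> by (rule prob_space_path_measure)
  obtain u \<kappa> where \<kappa>: "0 < \<kappa>" "\<kappa> < (1::real)" and u: "\<And>s. 1 \<le> u s"
    "\<And>s. s \<in> T \<Longrightarrow> avg P u s \<le> \<kappa> * u s" "\<And>s. s \<notin> T \<Longrightarrow> avg P u s \<le> u s"
    by (rule K.lyapunov) (rule that)
  define c where "c s = (if s \<in> T then 1 / \<kappa> else 1)" for s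
  define u0 where "u0 = u (init M)"
  have u0: "1 \<le> u0" by (simp add: u0_def u)
  have c: "0 < c s" for s using \<kappa> by (simp add: c_def)
  have u_nonneg: "0 \<le> u s" for s using u(1)[of s] by simp
  have "(\<Sum>t<n. \<Sum>s\<in>T. p t s) \<le> (kl + ln u0) / - ln \<kappa>" for n
  proof -
    define W where "W q = (\<Prod>t<n. c (q t)) / u0" for q
    have W_pos: "0 < W q" for q using u0 c by (simp add: W_def prod_pos)
    have m: "W \<in> borel_measurable \<S>"
      unfolding W_def[abs_def] by (intro borel_measurable_divide borel_measurable_prod measurable_path_state borel_measurable_const)
    \<comment> \<open>As \<open>u\<close> is at least 1, its final value may be inserted, which
      produces the supermartingale.\<close>
    have "(\<integral>\<^sup>+q. ennreal (W q) \<partial>\<S>) \<le> (\<integral>\<^sup>+q. ennreal ((\<Prod>t<n. c (q t)) * (u (q n) / u0)) \<partial>\<S>)"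
    proof (intro nn_integral_mono ennreal_leI)
      fix q
      have "(\<Prod>t<n. c (q t)) * (1 / u0) \<le> (\<Prod>t<n. c (q t)) * (u (q n) / u0)"
        using u0 u(1)[of "q n"] c by (intro mult_left_mono divide_right_mono prod_nonneg) (auto intro: less_imp_le)
      then show "W q \<le> (\<Prod>t<n. c (q t)) * (u (q n) / u0)" by (simp add: W_def)
    qed
    also have "\<dots> \<le> ennreal (u (init M) / u0)"
    proof (rule nn_integral_supermartingale[where \<mu>=\<mu>S and u="\<lambda>s. u s / u0"])
      fix s
      have "avg P (\<lambda>s. u s / u0) s = avg P u s / u0"
        by (simp add: avg_def sum_divide_distrib)
      moreover have "c s * avg P u s \<le> u s"
        using u(2,3)[of s] \<kappa> by (auto simp: c_def field_simps)
      then have "c s * avg P u s / u0 \<le> u s / u0"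
        using u0 by (intro divide_right_mono) auto
      ultimately show "c s * avg (\<lambda>s. bind_pmf (\<mu>S s) (trans M s)) (\<lambda>s. u s / u0) s \<le> u s / u0"
        unfolding P_def[abs_def] by simp
    qed (use stS c u_nonneg u0 in \<open>auto intro: less_imp_le\<close>)
    also have "\<dots> = 1" using u0 by (simp add: u0_def)
    finally have le1: "(\<integral>\<^sup>+q. ennreal (W q) \<partial>\<S>) \<le> 1" .
    have ln_W: "ln (W q) = (\<Sum>t<n. ln (c (q t))) - ln u0" for q
    proof -
      have "c (q t) \<noteq> 0" for t using c[of "q t"] by simp
      then show ?thesis using u0 by (simp add: W_def ln_div ln_prod)
    qed
    have int_c: "integrable \<A> (\<lambda>q. ln (c (q t)))" for t
      by (rule expectation_state(2)[where \<phi>="\<lambda>s. ln (c s)"])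
    have "(\<Sum>t<n. \<Sum>s\<in>T. p t s) * - ln \<kappa> - ln u0 = (\<Sum>t<n. \<integral>q. ln (c (q t)) \<partial>\<A>) - ln u0"
    proof -
      have "(\<integral>q. ln (c (q t)) \<partial>\<A>) = (\<Sum>s\<in>T. p t s) * - ln \<kappa>" for t
      proof -
        have "(\<integral>q. ln (c (q t)) \<partial>\<A>) = (\<Sum>s\<in>UNIV. p t s * ln (c s))"
          by (rule expectation_state(1)[where \<phi>="\<lambda>s. ln (c s)"])
        also have "\<dots> = (\<Sum>s\<in>T. p t s * ln (c s))"
          by (rule sum.mono_neutral_right) (auto simp: c_def)
        also have "\<dots> = (\<Sum>s\<in>T. p t s * - ln \<kappa>)"
          using \<kappa> by (intro sum.cong) (auto simp: c_def ln_div)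
        finally show ?thesis by (simp only: sum_distrib_right)
      qed
      then show ?thesis by (simp only: sum_distrib_right)
    qed
    also have "\<dots> = (\<integral>q. ln (W q) \<partial>\<A>)"
      using int_c A.prob_space by (simp add: ln_W)
    also have "\<dots> \<le> kl"
      using m W_pos le1 by (intro variational) (auto simp: ln_W int_c intro: less_imp_le)
    finally have "(\<Sum>t<n. \<Sum>s\<in>T. p t s) * - ln \<kappa> \<le> kl + ln u0" by simp
    moreover have "0 < - ln \<kappa>" using \<kappa> by simp
    ultimately show ?thesis by (simp only: pos_le_divide_eq)
  qed
  then show ?thesis by blast
qed

lemma visits_summable: assumes "s \<in> T" shows "summable (\<lambda>t. p t s)"
proof -
  obtain B where B: "\<And>n. (\<Sum>t<n. \<Sum>s\<in>T. p t s) \<le> B" using visits_bounded by blast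
  show ?thesis
  proof (rule summableI_nonneg_bounded)
    show "(\<Sum>t<n. p t s) \<le> B" for n
    proof -
      have "p t s \<le> (\<Sum>s\<in>T. p t s)" for t
        using assms by (intro member_le_sum) auto
      then have "(\<Sum>t<n. p t s) \<le> (\<Sum>t<n. \<Sum>s\<in>T. p t s)" by (intro sum_mono)
      then show ?thesis using B[of n] by linarith
    qed
  qed simp
qed

text \<open>The series below are known to converge only for \<open>s \<in> T\<close>; their values elsewhere are never used.\<close>

definition x where "x s = (\<Sum>t. p t s)"
definition y where "y s a = (\<Sum>t. pmf (act_pmf M \<pi>A t) (s, a))"
definition \<mu> where "\<mu> s = (if s \<in> T \<and> 0 < x s then embed_pmf (\<lambda>a. y s a / x s) else \<mu>S s)"
definition Q where "Q s = bind_pmf (\<mu> s) (trans M s)"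
definition \<pi>Q :: "('s, 'a) policy" where "\<pi>Q h = \<mu> (last_state h)"
text \<open>Where \<open>pmf (P s) q\<close> is 0, division gives 0; this is the right value, since
  \<open>Q s\<close> has no mass there either.\<close>

definition r where "r s q = (if s \<in> T then pmf (Q s) q / pmf (P s) q else 1)"

section \<open>Action frequencies and the kernel of the averaged policy\<close>

lemma act_le: "pmf (act_pmf M \<pi>A t) (s, a) \<le> p t s"
  unfolding sum_act[symmetric] by (intro member_le_sum) auto

lemma act_sums: "s \<in> T \<Longrightarrow> (\<lambda>t. pmf (act_pmf M \<pi>A t) (s, a)) sums y s a"
  unfolding y_def
  by (intro summable_sums summable_comparison_test'[OF visits_summable]) (auto simp: act_le)

lemma y_nonneg: "s \<in> T \<Longrightarrow> 0 \<le> y s a"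
  by (rule sums_le[OF _ sums_zero act_sums]) auto

lemma y_unavailable: "a \<notin> avail M s \<Longrightarrow> y s a = 0"
  by (simp add: y_def act_pmf_unavailable[OF pol_A])

lemma sum_y: "s \<in> T \<Longrightarrow> (\<Sum>a\<in>UNIV. y s a) = x s"
  unfolding x_def sum_act[symmetric] by (rule sums_unique) (intro sums_sum act_sums)

lemma pmf_\<mu>: assumes "s \<in> T" "0 < x s" shows "pmf (\<mu> s) a = y s a / x s"
proof -
  have "(\<Sum>a\<in>UNIV. y s a / x s) = 1"
    using assms sum_y by (simp add: sum_divide_distrib[symmetric])
  then have "(\<integral>\<^sup>+a. ennreal (y s a / x s) \<partial>count_space UNIV) = 1"
    using assms y_nonneg by (subst nn_integral_count_space_finite) (auto simp: sum_ennreal)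
  then show ?thesis
    using assms y_nonneg by (simp add: \<mu>_def pmf_embed_pmf)
qed

text \<open>If \<open>x s = 0\<close>, both sides vanish whatever \<open>\<mu> s\<close> is, so the
  identity covers unvisited states as well.\<close>

lemma y_eq: assumes "s \<in> T" shows "y s a = x s * pmf (\<mu> s) a"
proof (cases "0 < x s")
  case True
  then show ?thesis using assms by (simp add: pmf_\<mu>)
next
  case False
  have "y s a \<le> (\<Sum>a\<in>UNIV. y s a)" using y_nonneg[OF assms] by (intro member_le_sum) auto
  moreover have "0 \<le> (\<Sum>a\<in>UNIV. y s a)" using y_nonneg[OF assms] by (intro sum_nonneg) auto
  ultimately have "y s a = 0" "x s = 0"
    using False y_nonneg[OF assms, of a] sum_y[OF assms] by auto
  then show ?thesis by simp
qed

lemma avail_\<mu>: "set_pmf (\<mu> s) \<subseteq> avail M s"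
proof (cases "s \<in> T \<and> 0 < x s")
  case True
  show ?thesis
  proof
    fix a assume "a \<in> set_pmf (\<mu> s)"
    then have "y s a \<noteq> 0" using True by (auto simp: set_pmf_iff pmf_\<mu>)
    then show "a \<in> avail M s" using y_unavailable by blast
  qed
next
  case False
  then show ?thesis using avail_S[of s] by (auto simp: \<mu>_def)
qed

lemma pol_Q: "\<pi>Q \<in> policies M"
  using avail_\<mu> by (auto simp: policies_def \<pi>Q_def)

lemma stationary_Q: "stationary \<pi>Q"
  by (auto simp: stationary_def \<pi>Q_def)

lemma Q_eq_P: "\<not> (s \<in> T \<and> 0 < x s) \<Longrightarrow> Q s = P s"
  by (auto simp: Q_def P_def \<mu>_def)

text \<open>The reason for averaging: summed over time, the flow of \<open>\<pi>A\<close> out of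
  \<open>s\<close> is that of a stationary kernel applied to the visit count.\<close>

lemma moves_sums: assumes "s \<in> T" shows "(\<lambda>t. J t s q) sums (x s * pmf (Q s) q)"
proof -
  have "(\<lambda>t. J t s q) sums (\<Sum>a\<in>UNIV. y s a * pmf (trans M s a) q)"
    unfolding pmf_move by (intro sums_sum sums_mult2 act_sums assms)
  moreover have "pmf (Q s) q = (\<Sum>a\<in>UNIV. pmf (trans M s a) q * pmf (\<mu> s) a)"
    unfolding Q_def pmf_bind by (subst integral_measure_pmf_real[of UNIV]) auto
  ultimately show ?thesis
    by (simp add: y_eq[OF assms] sum_distrib_left mult_ac)
qed

sublocale flow p J "init M" T x Q
proof
  show "(\<lambda>t. p t s) sums x s" if "s \<in> T" for s
    unfolding x_def using visits_summable[OF that] by (rule summable_sums)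
qed (auto simp: sum_move_left sum_move_right state_pmf_0 indicator_def moves_sums)

text \<open>At a visited state of T, an edge charged by \<open>Q\<close> has positive total flow, so
  \<open>\<pi>A\<close> uses it at some time; elsewhere \<open>Q\<close> is
  \<open>P\<close>.\<close>

lemma Q_ac: assumes "pmf (Q s) q > 0" shows "pmf (P s) q > 0"
proof (cases "s \<in> T \<and> 0 < x s")
  case True
  then have "0 < x s * pmf (Q s) q" using assms by simp
  moreover have "(\<lambda>t. J t s q) sums (x s * pmf (Q s) q)" using True by (intro moves_sums) simp
  ultimately obtain t where "J t s q \<noteq> 0" by (metis less_irrefl sums_0 sums_unique2)
  then show ?thesis by (intro J_ac[of t]) (simp add: less_le)
qed (use assms Q_eq_P in auto)

lemma J_ac_Q: assumes "s \<in> T" "J t s q > 0" shows "pmf (Q s) q > 0"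
proof -
  have "J t s q \<le> x s * pmf (Q s) q"
    using sums_le[OF _ sums_single[of t "\<lambda>t. J t s q"] moves_sums[OF assms(1), of q]] by simp
  then show ?thesis using assms by (cases "pmf (Q s) q = 0") (auto simp: less_le)
qed

sublocale lik: likelihood M \<pi>S \<pi>Q \<mu>S \<mu> P Q T r
proof
  show "pmf (Q s) q = r s q * pmf (P s) q" for s q
    using Q_ac[of s q] Q_eq_P[of s] by (cases "pmf (Q s) q = 0") (auto simp: r_def less_le)
  show "q \<notin> T" if "s \<notin> T" "pmf (P s) q > 0" for s q
    using that by (rule K.resolved_closed)
qed (auto simp: stS \<pi>Q_def P_def Q_def r_def)

lemma stQ: "\<pi>Q h = \<mu> (last_state h)" by (simp add: \<pi>Q_def)

lemma state_Q: "(\<Sum>s\<in>UNIV. pmf (state_pmf M \<pi>Q n) s * \<phi> s) = (avg Q ^^ n) \<phi> (init M)"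
  by (rule state_pmf_avg[where \<mu>=\<mu>]) (simp_all add: stQ Q_def)

lemma occupation_Q:
  assumes "\<And>s. 0 \<le> c s" "\<And>s. s \<notin> T \<Longrightarrow> c s = 0"
  shows "(\<Sum>t<k. \<Sum>s\<in>T. pmf (state_pmf M \<pi>Q t) s * c s) \<le> (\<Sum>s\<in>T. x s * c s)"
proof -
  have "(\<Sum>s\<in>T. pmf (state_pmf M \<pi>Q t) s * c s) = (avg Q ^^ t) c (init M)" for t
    unfolding state_Q[symmetric] by (rule sum.mono_neutral_left) (auto simp: assms)
  then show ?thesis
    using occupation_bound[OF lik.closed_Q J_closed assms] by simp
qed

text \<open>The occupation bound for the indicator of \<open>s\<close> limits the expected visits of
  the new policy to \<open>s\<close> by \<open>x s\<close>.\<close>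

sublocale lik: transient_likelihood M \<pi>S \<pi>Q \<mu>S \<mu> P Q T r
proof
  fix s assume s: "s \<in> T"
  show "summable (\<lambda>t. pmf (state_pmf M \<pi>Q t) s)"
  proof (rule summableI_nonneg_bounded)
    have "(\<Sum>s'\<in>T. f s' * indicator {s} s') = f s" for f :: "'s \<Rightarrow> real"
      using s by (simp add: indicator_def if_distrib cong: if_cong)
    then show "(\<Sum>t<k. pmf (state_pmf M \<pi>Q t) s) \<le> x s" for k
      using occupation_Q[of "indicator {s}" k] s by (auto simp: indicator_def)
  qed simp
qed

text \<open>The relative entropy of \<open>Q s\<close> with respect to \<open>P s\<close>, as
  \<open>r\<close> is the ratio on T and both kernels agree off T.\<close>

definition D where "D s = avg Q (\<lambda>q. ln (r s q)) s"

text \<open>Gibbs' inequality from ln z \<le> z - 1. The sign lets \<open>D\<close> serve as a cost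
  in the occupation bound.\<close>

lemma D_nonneg: "0 \<le> D s"
proof (cases "s \<in> T")
  case True
  have "pmf (Q s) q - pmf (P s) q \<le> pmf (Q s) q * ln (r s q)" for q
  proof (cases "pmf (Q s) q = 0")
    case False
    then have pos: "0 < pmf (Q s) q" "0 < pmf (P s) q" using Q_ac[of s q] by (simp_all add: less_le)
    have "- ln (r s q) = ln (pmf (P s) q / pmf (Q s) q)"
      using pos True by (simp add: r_def ln_div)
    also have "\<dots> \<le> pmf (P s) q / pmf (Q s) q - 1" using pos by (intro ln_le_minus_one) simp
    finally have "pmf (Q s) q * (1 - pmf (P s) q / pmf (Q s) q) \<le> pmf (Q s) q * ln (r s q)"
      by (intro mult_left_mono) auto
    then show ?thesis using pos by (simp add: right_diff_distrib)
  qed simp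
  then have "(\<Sum>q\<in>UNIV. pmf (Q s) q - pmf (P s) q) \<le> D s"
    unfolding D_def avg_def by (intro sum_mono)
  then show ?thesis by (simp add: sum_subtractf sum_pmf_UNIV)
next
  case False
  have "D s = 0" unfolding D_def by (rule avg_const) (simp add: r_def False)
  then show ?thesis by simp
qed

lemma D_off: "s \<notin> T \<Longrightarrow> D s = 0"
  unfolding D_def by (rule avg_const) (simp add: r_def)

section \<open>Comparison of divergences and of reachability\<close>

lemma KL_Q: "KL (path_measure M \<pi>Q) \<S> \<le> ereal (\<Sum>s\<in>T. x s * D s)"
proof -
  obtain z where z: "(\<lambda>t. \<Sum>s\<in>T. pmf (state_pmf M \<pi>Q t) s * D s) sums z"
    "KL (path_measure M \<pi>Q) \<S> = ereal z"
    using lik.KL_path_measure unfolding D_def by blast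
  have "z \<le> (\<Sum>s\<in>T. x s * D s)"
    using z(1) unfolding sums_def
    by (rule LIMSEQ_le_const2) (use occupation_Q[of D, OF D_nonneg D_off] in blast)
  then show ?thesis using z by simp
qed

text \<open>The weight in the variational bound is now the likelihood ratio \<open>lik.L n\<close>,
  whose reference mean is 1. The expectation of its logarithm under \<open>\<pi>A\<close> is a
  partial sum of flows times log ratios, and \<open>moves_sums\<close> evaluates the series.\<close>

lemma KL_A: "(\<Sum>s\<in>T. x s * D s) \<le> kl"
proof -
  define e where "e t = (\<integral>q. ln (r (q t) (q (Suc t))) \<partial>\<A>)" for t
  have int_r: "integrable \<A> (\<lambda>q. ln (r (q t) (q (Suc t))))" for t
    by (rule expectation_move(2)[where \<phi>="\<lambda>s q. ln (r s q)"])
  \<comment> \<open>Moves of \<open>\<pi>A\<close> out of T are possible under both kernels, so its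
    log ratios are finite and add up to the logarithm of the product.\<close>
  have pos: "AE q in \<A>. \<forall>t. 0 < r (q t) (q (Suc t))"
    unfolding AE_all_countable
  proof
    fix t show "AE q in \<A>. 0 < r (q t) (q (Suc t))"
      by (subst AE_move) (auto simp: r_def intro!: divide_pos_pos J_ac J_ac_Q)
  qed
  have bound: "(\<Sum>t<n. e t) \<le> kl" for n
  proof -
    have ae: "AE q in \<A>. (\<Sum>t<n. ln (r (q t) (q (Suc t)))) = ln (lik.L n q)"
      using pos
    proof eventually_elim
      case (elim q)
      then show ?case unfolding lik.L_def by (subst ln_prod) (auto simp: less_imp_neq[THEN not_sym])
    qed
    have m: "(\<lambda>q. ln (lik.L n q)) \<in> borel_measurable \<A>" by measurable
    have i: "integrable \<A> (\<lambda>q. \<Sum>t<n. ln (r (q t) (q (Suc t))))"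
      by (intro Bochner_Integration.integrable_sum int_r)
    have "(\<Sum>t<n. e t) = (\<integral>q. (\<Sum>t<n. ln (r (q t) (q (Suc t)))) \<partial>\<A>)"
      unfolding e_def using int_r by (subst Bochner_Integration.integral_sum) auto
    also have "\<dots> = (\<integral>q. ln (lik.L n q) \<partial>\<A>)"
      using i m ae by (intro integral_cong_AE) auto
    also have "\<dots> \<le> kl"
    proof (rule variational)
      show "AE q in \<A>. 0 < lik.L n q"
        using pos by eventually_elim (simp add: lik.L_def prod_pos)
      show "integrable \<A> (\<lambda>q. ln (lik.L n q))" by (rule integrable_cong_AE_imp[OF i m]) (use ae in auto)
    qed (auto simp: lik.L_nonneg lik.nn_integral_L)
    finally show ?thesis .
  qed
  have "e t = (\<Sum>s\<in>T. \<Sum>q\<in>UNIV. J t s q * ln (r s q))" for t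
  proof -
    have "e t = (\<Sum>s\<in>UNIV. \<Sum>q\<in>UNIV. J t s q * ln (r s q))"
      unfolding e_def by (rule expectation_move(1)[where \<phi>="\<lambda>s q. ln (r s q)"])
    also have "\<dots> = (\<Sum>s\<in>T. \<Sum>q\<in>UNIV. J t s q * ln (r s q))"
      by (rule sum.mono_neutral_right) (auto simp: r_def)
    finally show ?thesis .
  qed
  then have "e = (\<lambda>t. \<Sum>s\<in>T. \<Sum>q\<in>UNIV. J t s q * ln (r s q))" by (rule ext)
  then have "e sums (\<Sum>s\<in>T. \<Sum>q\<in>UNIV. x s * pmf (Q s) q * ln (r s q))"
    by (simp only:) (intro sums_sum sums_mult2 moves_sums)
  also have "(\<Sum>s\<in>T. \<Sum>q\<in>UNIV. x s * pmf (Q s) q * ln (r s q)) = (\<Sum>s\<in>T. x s * D s)"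
    by (simp add: D_def avg_def sum_distrib_left mult.assoc)
  finally show ?thesis
    unfolding sums_def by (rule LIMSEQ_le_const2) (use bound in blast)
qed

text \<open>Let \<open>h\<close> be the reaching probability of \<open>Q\<close>. It is harmonic, 1
  on \<open>R\<close>, and 0 on states outside both \<open>R\<close> and T. The mean of
  \<open>h\<close> under \<open>\<pi>A\<close> therefore tends to \<open>h (init M)\<close>, and
  since the mass on T dies out, also to the reachability of \<open>\<pi>A\<close>.\<close>

lemma reach_Q: "reach_prob M \<pi>Q R = reach_prob M \<pi>A R"
proof -
  interpret KQ: absorbing_kernel Q R
    by standard (simp add: Q_def absorbing_bind avail_\<mu> absorb)
  have "\<exists>l. (\<lambda>n. KQ.hit n s) \<longlonglongrightarrow> l" for s
    using incseq_convergent[of "\<lambda>n. KQ.hit n s" 1] KQ.hit_le_1 KQ.hit_Suc by (metis incseq_SucI)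
  then obtain h where h: "\<And>s. (\<lambda>n. KQ.hit n s) \<longlonglongrightarrow> h s" by metis
  have h_R: "h s = 1" if "s \<in> R" for s
    using h[of s] unfolding KQ.hit_R[OF that] by (simp add: LIMSEQ_const_iff)
  have h_0: "h s = 0" if "s \<notin> T" "s \<notin> R" for s
  proof -
    have "KQ.hit n s = 0" for n
    proof (rule avg_funpow_closed[where B="- (T \<union> R)"])
      \<comment> \<open>Closedness under \<open>P\<close> passes to \<open>Q\<close> because
        \<open>Q\<close> charges no edge outside the support of \<open>P\<close>.\<close>
      fix s q assume *: "s \<in> - (T \<union> R)" "pmf (Q s) q > 0"
      then show "q \<in> - (T \<union> R)" using K.avoid_closed[of s q] Q_ac[of s q] by auto
    qed (use that in auto)
    then show ?thesis using h[of s] by (simp add: LIMSEQ_const_iff)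
  qed
  have harm: "avg Q h s = h s" for s
  proof (rule LIMSEQ_unique)
    show "(\<lambda>n. KQ.hit (Suc n) s) \<longlonglongrightarrow> h s" using h by (rule LIMSEQ_Suc)
    show "(\<lambda>n. KQ.hit (Suc n) s) \<longlonglongrightarrow> avg Q h s"
      unfolding avg_def[of Q h] funpow.simps comp_def avg_def[of Q "KQ.hit _"] by (intro tendsto_intros h)
  qed
  have "(\<lambda>n. \<Sum>s\<in>UNIV. p n s * h s) \<longlonglongrightarrow> h (init M) + (\<Sum>s\<in>T. x s * (avg Q h s - h s))"
  proof (rule potential_limit)
    fix t s q assume *: "s \<notin> T" "J t s q > 0"
    show "h q = h s"
    proof (cases "s \<in> R")
      case True
      then show ?thesis using absorbing_move[OF pol_A absorb *(2)] by simp
    next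
      case False
      then show ?thesis using K.avoid_closed[OF *(1) False J_ac[OF *(2)]] * by (simp add: h_0)
    qed
  qed
  \<comment> \<open>Harmonicity cancels the sum over T, so the visit counts drop out of the
    limit.\<close>
  then have lim: "(\<lambda>n. \<Sum>s\<in>UNIV. p n s * h s) \<longlonglongrightarrow> h (init M)" by (simp add: harm)
  have "(\<Sum>s\<in>UNIV. p n s * h s) = (\<Sum>s\<in>R. p n s) + (\<Sum>s\<in>T. p n s * h s)" for n
  proof -
    have "(\<Sum>s\<in>UNIV. p n s * h s) = (\<Sum>s\<in>R \<union> T. p n s * h s)"
      by (rule sum.mono_neutral_right) (auto simp: h_0)
    also have "\<dots> = (\<Sum>s\<in>R. p n s * h s) + (\<Sum>s\<in>T. p n s * h s)"
      by (rule sum.union_disjoint) (auto simp: K.unresolved_def)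
    finally show ?thesis by (simp add: h_R)
  qed
  then have "(\<Sum>s\<in>R. p n s) = (\<Sum>s\<in>UNIV. p n s * h s) - (\<Sum>s\<in>T. p n s * h s)" for n by simp
  moreover have "(\<lambda>n. (\<Sum>s\<in>UNIV. p n s * h s) - (\<Sum>s\<in>T. p n s * h s)) \<longlonglongrightarrow> h (init M) - (\<Sum>s\<in>T. 0 * h s)"
    by (intro tendsto_intros lim p_tendsto_0)
  ultimately have "(\<lambda>n. \<Sum>s\<in>R. p n s) \<longlonglongrightarrow> h (init M)" by simp
  then have A: "reach_prob M \<pi>A R = h (init M)"
    using reach_prob_limit(1)[OF pol_A absorb] by (rule LIMSEQ_unique[rotated])
  have "(\<Sum>s\<in>R. pmf (state_pmf M \<pi>Q n) s) = KQ.hit n (init M)" for n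
  proof -
    have "(\<Sum>s\<in>R. pmf (state_pmf M \<pi>Q n) s) = (\<Sum>s\<in>UNIV. pmf (state_pmf M \<pi>Q n) s * indicator R s)"
      by (simp add: indicator_def if_distrib sum.inter_filter[symmetric] cong: if_cong)
    then show ?thesis by (simp only: state_Q)
  qed
  then have "(\<lambda>n. \<Sum>s\<in>R. pmf (state_pmf M \<pi>Q n) s) \<longlonglongrightarrow> h (init M)" using h by simp
  then have "reach_prob M \<pi>Q R = h (init M)"
    using reach_prob_limit(1)[OF pol_Q absorb] by (rule LIMSEQ_unique[rotated])
  with A show ?thesis by simp
qed

end

section \<open>The two cases of finite and infinite divergence\<close>

theorem proposition2:
  fixes M :: "('s::finite, 'a::finite) mdp"
    and R :: "'s set"
    and \<nu> :: real
    and \<pi>\<^sub>S \<pi>\<^sub>A :: "('s, 'a) policy"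
  assumes "\<And>s. s \<in> R \<Longrightarrow> absorbing M s"
    and "0 \<le> \<nu>" and "\<nu> \<le> 1"
    and "\<pi>\<^sub>S \<in> policies M" and "stationary \<pi>\<^sub>S"
    and "\<pi>\<^sub>A \<in> policies M"
    and "reach_prob M \<pi>\<^sub>A R \<ge> \<nu>"
  shows "\<exists>\<pi>\<in>policies M. stationary \<pi> \<and> reach_prob M \<pi> R \<ge> \<nu> \<and>
    KL (path_measure M \<pi>) (path_measure M \<pi>\<^sub>S) \<le> KL (path_measure M \<pi>\<^sub>A) (path_measure M \<pi>\<^sub>S)"
proof (cases "absolutely_continuous (path_measure M \<pi>\<^sub>S) (path_measure M \<pi>\<^sub>A) \<and>
    integrable (path_measure M \<pi>\<^sub>A) (entropy_density (exp 1) (path_measure M \<pi>\<^sub>S) (path_measure M \<pi>\<^sub>A))")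
  case True
  obtain \<mu>S where "\<And>h. \<pi>\<^sub>S h = \<mu>S (last_state h)"
    using assms(5) by (auto simp: stationary_def)
  then interpret finite_kl M R \<pi>\<^sub>S \<pi>\<^sub>A \<mu>S
    using True assms by unfold_locales auto
  have "KL (path_measure M \<pi>Q) (path_measure M \<pi>\<^sub>S) \<le> KL (path_measure M \<pi>\<^sub>A) (path_measure M \<pi>\<^sub>S)"
    using KL_Q KL_A True by (auto simp: KL_def[of "path_measure M \<pi>\<^sub>A"] intro: order_trans)
  then show ?thesis
    using pol_Q stationary_Q reach_Q assms(7) by auto
next
  \<comment> \<open>The right side is infinite, so only the reachability constraint remains.\<close>
  case False
  then have "KL (path_measure M \<pi>\<^sub>A) (path_measure M \<pi>\<^sub>S) = \<infinity>" by (auto simp: KL_def)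
  moreover obtain \<pi> where "\<pi> \<in> policies M" "stationary \<pi>" "reach_prob M \<pi>\<^sub>A R \<le> reach_prob M \<pi> R"
    using stationary_maximizes_reach[OF assms(6,1)] by blast
  ultimately show ?thesis using assms(7) by (intro bexI[of _ \<pi>]) auto
qed

end
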